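(* Let $Y$ be an observation from the degree corrected two-star ERGM $\mathbb{P}_{n,\theta,\bm\beta}$ on $\{-1,1\}^{\binom n2}$, and assume $(\theta,\beta_0)=(\frac12,0)$. Consider testing $\mathcal{H}_0:\bm\beta=\mathbf 0$ against $\mathcal{H}_1:\bm\beta\in\Xi(s,A)$ with $s=n^b$, $A=n^t$ for fixed $b\in(0,1)$ and $t<0$. (a) If $b+t+\frac12<0$, then all (sequences of) tests are asymptotically not powerful. (b) If $b+t+\frac12>0$, then there exists a sequence $L_n\gg n^{3/2}$ such that the total degree test $T_n=\mathbf 1\{\sum_{i=1}^nk_i>L_n\}$ is asymptotically powerful.
   Context: $Y$ is a symmetric $n\times n$ matrix with $Y_{ij}\in\{-1,1\}$ for $i\ne j$ and $Y_{ii}=0$. Set $k_i=\sum_{j=1}^nY_{ij}$. The degree corrected two-star ERGM is $$\mathbb{P}_{n,\theta,\bm\beta}(Y)=\frac1{Z_n(\bm\beta,\theta)}\exp\Big\{\frac{\theta}{n-1}\Big(\frac12\sum_{i=1}^nk_i^2-\frac{n(n-1)}2\Big)+\frac12\sum_{i=1}^n\beta_ik_i\Big\},\quad\bm\beta\in\mathbb{R}^n,$$ with $Z_n$ the normalizing constant. With $\beta_0=0$ the alternative is $$\Xi(s,A)=\{\bm\beta=\bm\mu\in\mathbb{R}^n:\ |\mathrm{supp}(\bm\mu)|\ge s,\ \min_{i\in\mathrm{supp}(\bm\mu)}\mu_i\ge A\}.$$ A (non-randomized) test is a function $T_n$ of $Y$ with values in $\{0,1\}$; its risk is $$R(T_n)=\mathbb{P}_{n,\theta,\mathbf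 0}(T_n=1)+\sup_{\bm\beta\in\Xi(s,A)}\mathbb{P}_{n,\theta,\bm\beta}(T_n=0).$$ A sequence $\{T_n\}$ is asymptotically powerful if $\lim_nR(T_n)=0$, and asymptotically not powerful if $\liminf_nR(T_n)>0$. $a_n\gg b_n$ means $a_n/b_n\to\infty$. *)

theory Defs
  imports
    "HOL-Probability.Probability"
    "Jordan_Normal_Form.Matrix"
begin

unbundle no vec_syntax

definition sign_graphs :: "nat \<Rightarrow> real mat set" where
  "sign_graphs n = {Y \<in> carrier_mat n n.
     transpose_mat Y = Y \<and>
     (\<forall>i<n. \<forall>j<n. i \<noteq> j \<longrightarrow> Y $$ (i, j) \<in> {-1, 1}) \<and>
     (\<forall>i<n. Y $$ (i, i) = 0)}"

definition node_degree :: "real mat \<Rightarrow> nat \<Rightarrow> real" where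
  "node_degree Y i = (\<Sum>j<dim_col Y. Y $$ (i, j))"

definition ergm_weight :: "nat \<Rightarrow> real \<Rightarrow> real Matrix.vec \<Rightarrow> real mat \<Rightarrow> real" where
  "ergm_weight n \<theta> \<beta> Y =
     exp (\<theta> / (real n - 1) * (1 / 2 * (\<Sum>i<n. (node_degree Y i)\<^sup>2) - real n * (real n - 1) / 2)
          + 1 / 2 * (\<Sum>i<n. \<beta> $ i * node_degree Y i))"

definition ergm_Z :: "nat \<Rightarrow> real \<Rightarrow> real Matrix.vec \<Rightarrow> real" where
  "ergm_Z n \<theta> \<beta> = (\<Sum>Y\<in>sign_graphs n. ergm_weight n \<theta> \<beta> Y)"

definition ergm :: "nat \<Rightarrow> real \<Rightarrow> real Matrix.vec \<Rightarrow> real mat pmf" where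
  "ergm n \<theta> \<beta> =
     embed_pmf (\<lambda>Y. if Y \<in> sign_graphs n then ergm_weight n \<theta> \<beta> Y / ergm_Z n \<theta> \<beta> else 0)"

lemma finite_sign_graphs: "finite (sign_graphs n)"
proof -
  have "sign_graphs n \<subseteq>
    (\<lambda>f. mat n n f) ` (({..<n} \<times> {..<n}) \<rightarrow>\<^sub>E {-1, 0, 1::real})"
  proof
    fix Y assume Y: "Y \<in> sign_graphs n"
    have "Y = mat n n (restrict (\<lambda>p. Y $$ p) ({..<n} \<times> {..<n}))"
      using Y by (intro eq_matI) (auto simp: sign_graphs_def)
    moreover have "restrict (\<lambda>p. Y $$ p) ({..<n} \<times> {..<n}) \<in>
        ({..<n} \<times> {..<n}) \<rightarrow>\<^sub>E {-1, 0, 1::real}"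
    proof (rule restrict_PiE_iff[THEN iffD2], rule ballI)
      fix p assume "p \<in> {..<n} \<times> {..<n}"
      then obtain i j where "p = (i, j)" "i < n" "j < n" by auto
      then show "Y $$ p \<in> {-1, 0, 1}"
        using Y unfolding sign_graphs_def by (cases "i = j") auto
    qed
    ultimately show "Y \<in> (\<lambda>f. mat n n f) ` (({..<n} \<times> {..<n}) \<rightarrow>\<^sub>E {-1, 0, 1::real})"
      by blast
  qed
  then show ?thesis
    by (rule finite_subset) (intro finite_imageI finite_PiE; simp)
qed

lemma sign_graphs_nonempty: "sign_graphs n \<noteq> {}"
proof -
  have "mat n n (\<lambda>(i, j). if i = j then 0 else 1) \<in> sign_graphs n"
    by (auto simp: sign_graphs_def intro!: eq_matI)
  then show ?thesis by blast
qed

lemma ergm_Z_pos: "ergm_Z n \<theta> \<beta> > 0"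
  unfolding ergm_Z_def
  by (intro sum_pos finite_sign_graphs sign_graphs_nonempty) (simp add: ergm_weight_def)

lemma pmf_ergm:
  "pmf (ergm n \<theta> \<beta>) Y =
     (if Y \<in> sign_graphs n then ergm_weight n \<theta> \<beta> Y / ergm_Z n \<theta> \<beta> else 0)"
proof -
  let ?f = "\<lambda>Y. if Y \<in> sign_graphs n then ergm_weight n \<theta> \<beta> Y / ergm_Z n \<theta> \<beta> else 0"
  have nonneg: "0 \<le> ?f Y" for Y
    using ergm_Z_pos[of n \<theta> \<beta>] by (simp add: ergm_weight_def)
  have "(\<integral>\<^sup>+Y. ennreal (?f Y) \<partial>count_space UNIV) = (\<Sum>Y\<in>sign_graphs n. ennreal (?f Y))"
    by (rule nn_integral_count_space'[OF finite_sign_graphs]) auto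
  also have "\<dots> = ennreal (\<Sum>Y\<in>sign_graphs n. ?f Y)"
    using nonneg by (rule sum_ennreal)
  also have "(\<Sum>Y\<in>sign_graphs n. ?f Y) = 1"
    using ergm_Z_pos[of n \<theta> \<beta>]
    by (simp add: sum_divide_distrib[symmetric] ergm_Z_def[symmetric])
  finally show ?thesis
    unfolding ergm_def using nonneg by (subst pmf_embed_pmf) auto
qed

definition vec_supp :: "real Matrix.vec \<Rightarrow> nat set" where
  "vec_supp \<mu> = {i. i < dim_vec \<mu> \<and> \<mu> $ i \<noteq> 0}"

text \<open>The bound on the minimum over the support is stated elementwise, so that it holds
  vacuously if the support is empty (possible only for \<open>s \<le> 0\<close>).\<close>

definition alternative :: "nat \<Rightarrow> real \<Rightarrow> real \<Rightarrow> real Matrix.vec set" where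
  "alternative n s A = {\<mu> \<in> carrier_vec n.
     real (card (vec_supp \<mu>)) \<ge> s \<and> (\<forall>i\<in>vec_supp \<mu>. \<mu> $ i \<ge> A)}"

definition is_test :: "nat \<Rightarrow> (real mat \<Rightarrow> nat) \<Rightarrow> bool" where
  "is_test n T \<longleftrightarrow> T ` sign_graphs n \<subseteq> {0, 1}"

text \<open>The supremum is taken over the reals, hence meaningful only if the alternative is nonempty,
  that is, for \<open>s \<le> n\<close>. This always holds for \<open>s = n powr b\<close> with \<open>0 < b < 1\<close>.\<close>

definition risk :: "nat \<Rightarrow> real \<Rightarrow> real \<Rightarrow> real \<Rightarrow> (real mat \<Rightarrow> nat) \<Rightarrow> real" where
  "risk n \<theta> s A T =
     measure_pmf.prob (ergm n \<theta> (0\<^sub>v n)) {Y. T Y = 1} +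
     (SUP \<beta>\<in>alternative n s A. measure_pmf.prob (ergm n \<theta> \<beta>) {Y. T Y = 0})"

definition asymp_powerful ::
    "real \<Rightarrow> (nat \<Rightarrow> real) \<Rightarrow> (nat \<Rightarrow> real) \<Rightarrow> (nat \<Rightarrow> real mat \<Rightarrow> nat) \<Rightarrow> bool" where
  "asymp_powerful \<theta> s A T \<longleftrightarrow> (\<lambda>n. risk n \<theta> (s n) (A n) (T n)) \<longlonglongrightarrow> 0"

definition asymp_not_powerful ::
    "real \<Rightarrow> (nat \<Rightarrow> real) \<Rightarrow> (nat \<Rightarrow> real) \<Rightarrow> (nat \<Rightarrow> real mat \<Rightarrow> nat) \<Rightarrow> bool" where
  "asymp_not_powerful \<theta> s A T \<longleftrightarrow>
     liminf (\<lambda>n. ereal (risk n \<theta> (s n) (A n) (T n))) > 0"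

definition total_degree_test :: "nat \<Rightarrow> real \<Rightarrow> real mat \<Rightarrow> nat" where
  "total_degree_test n L Y = of_bool ((\<Sum>i<n. node_degree Y i) > L)"

definition much_greater :: "(nat \<Rightarrow> real) \<Rightarrow> (nat \<Rightarrow> real) \<Rightarrow> bool" where
  "much_greater a b \<longleftrightarrow> filterlim (\<lambda>n. a n / b n) at_top sequentially"

end

(*
  The Hubbard-Stratonovich transform writes the partition function as an integral over one real
  variable a_i per vertex, with one factor cosh (a_i + a_j) per edge. At theta = 1/2 the quadratic
  part of the exponent vanishes along the constant direction, and it is a nondegenerate Gaussian
  orthogonally to it. The gap x^2/2 - ln (cosh x) is convex and at most quartic; with Jensen's
  inequality this gives upper and lower bounds for the partition function which agree up to
  constants, and the sum of the a_i lives on the scale sqrt n.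

  Part (a): for the smallest signal, the ratio Z(beta) / Z(0) of partition functions is bounded by
  a constant. By the symmetry Y -> -Y the exponential tilt is at least 1 with null probability at
  least 1/2, hence the minimum of the two laws keeps mass.

  Part (b): both errors are Chernoff bounds, that is, ratios of partition functions with shifted
  parameters. For the second error the Ahlswede-Daykin inequality provides stochastic monotonicity
  in beta, which reduces the supremum to a small signal that is constant on a fixed support.
*)
theory Submission
  imports Defs "HOL-Real_Asymp.Real_Asymp"
begin

section \<open>Sign graphs as edge sets\<close>

text \<open>The threshold: a signal enters the integral through (n - 1) * sum beta_i a_i, and the
  part of a_i shared by all vertices is (sum a)/n, of order n^(-1/2). The effective signal is thus A
  * s * sqrt n = n^(b + t + 1/2). Heuristically the total degree is about 2 n times the sum of the
  a_i, which explains the scale n^(3/2).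

  The obstacle in part (b) is that the two bounds on the partition function cover different
  parameters: the upper one needs |sum b_i| * sqrt n at most 1, the lower one a constant vector.
  Hence the second Chernoff bound shifts by exactly minus the mean h of the signal, so that the
  parameters in the numerator sum to zero, while convexity and permutation symmetry lower the
  denominator to its value at the constant vector h. The upper bound also costs exp (n / 4 * sum
  b_i^2), so the signal has to be small, although the alternative contains arbitrarily large ones;
  monotonicity permits cutting it down. With the test threshold \<omega> * n^(3/2) and an effective
  signal cut to \<omega>^4, the exponent gains order \<omega>^5 against a quartic cost of order
  \<omega>^4.\<close>

definition edges :: "nat \<Rightarrow> (nat \<times> nat) set" where
  "edges n = {(i, j). i < j \<and> j < n}"

lemma edges_Suc: "edges (Suc n) = edges n \<union> (\<lambda>i. (i, n)) ` {..<n}"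
  by (auto simp: edges_def less_Suc_eq)

lemma finite_edges [simp]: "finite (edges n)"
  by (induction n) (simp_all add: edges_Suc, simp add: edges_def)

lemma sum_edges_Suc: "(\<Sum>(i, j)\<in>edges (Suc n). f i j) = (\<Sum>(i, j)\<in>edges n. f i j) + (\<Sum>i<n. f i n)"
  for f :: "nat \<Rightarrow> nat \<Rightarrow> real"
proof -
  have "edges n \<inter> (\<lambda>i. (i, n)) ` {..<n} = {}" by (auto simp: edges_def)
  then show ?thesis
    unfolding edges_Suc by (subst sum.union_disjoint) (simp_all add: sum.reindex inj_on_def)
qed

lemma sum_square_edges:
  fixes f :: "nat \<Rightarrow> nat \<Rightarrow> real"
  shows "(\<Sum>i<n. \<Sum>j<n. f i j) = (\<Sum>i<n. f i i) + (\<Sum>(i, j)\<in>edges n. f i j + f j i)"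
proof (induction n)
  case 0
  then show ?case by (simp add: edges_def)
next
  case (Suc n)
  then show ?case by (simp add: sum_edges_Suc sum.distrib)
qed

lemma card_edges: "real (card (edges n)) = real n * (real n - 1) / 2"
  using sum_square_edges[of "\<lambda>i j. 1" n]
  by (simp add: case_prod_unfold field_simps)

lemma sum_edges_add:
  fixes a :: "nat \<Rightarrow> real"
  shows "(\<Sum>(i, j)\<in>edges n. a i + a j) = (real n - 1) * (\<Sum>i<n. a i)"
  by (induction n) (simp_all add: sum_edges_Suc sum.distrib algebra_simps, simp add: edges_def)

text \<open>Each square occurs in n - 1 edges; one of these copies is spent on completing the cross
  terms to the square of the sum.\<close>

lemma sum_edges_power2:
  fixes a :: "nat \<Rightarrow> real"
  shows "(\<Sum>(i, j)\<in>edges n. (a i + a j)\<^sup>2) = (real n - 2) * (\<Sum>i<n. (a i)\<^sup>2) + (\<Sum>i<n. a i)\<^sup>2"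
proof (induction n)
  case (Suc n)
  have "(\<Sum>i<n. (a i + a n)\<^sup>2) = (\<Sum>i<n. (a i)\<^sup>2) + 2 * a n * (\<Sum>i<n. a i) + real n * (a n)\<^sup>2"
    by (simp add: power2_sum sum.distrib sum_distrib_left algebra_simps)
  then show ?case using Suc by (simp add: sum_edges_Suc power2_sum algebra_simps)
qed (simp add: edges_def)

definition edge_sign :: "(nat \<times> nat) set \<Rightarrow> nat \<times> nat \<Rightarrow> real" where
  "edge_sign A e = (if e \<in> A then 1 else - 1)"

text \<open>Coding sign graphs by sets of edges serves two purposes: a product over the edges
  expands into a sum over subsets, and union and intersection are the lattice operations of the four
  functions inequality.\<close>

definition sign_graph :: "nat \<Rightarrow> (nat \<times> nat) set \<Rightarrow> real mat" where
  "sign_graph n A = mat n n (\<lambda>(i, j). if i = j then 0 else edge_sign A (min i j, max i j))"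

lemma sign_graphs_sym: "Y \<in> sign_graphs n \<Longrightarrow> i < n \<Longrightarrow> j < n \<Longrightarrow> Y $$ (i, j) = Y $$ (j, i)"
  unfolding sign_graphs_def by (metis (mono_tags, lifting) carrier_matD index_transpose_mat(1) mem_Collect_eq)

lemma bij_betw_sign_graph: "bij_betw (sign_graph n) (Pow (edges n)) (sign_graphs n)"
proof (rule bij_betw_byWitness[where f' = "\<lambda>Y. {(i, j) \<in> edges n. Y $$ (i, j) = 1}"])
  show "\<forall>A\<in>Pow (edges n). {(i, j) \<in> edges n. sign_graph n A $$ (i, j) = 1} = A"
  proof
    fix A assume "A \<in> Pow (edges n)"
    then show "{(i, j) \<in> edges n. sign_graph n A $$ (i, j) = 1} = A"
      by (auto simp: sign_graph_def edges_def edge_sign_def min_def max_def split: if_splits)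
  qed
  show "\<forall>Y\<in>sign_graphs n. sign_graph n {(i, j) \<in> edges n. Y $$ (i, j) = 1} = Y"
  proof
    fix Y assume Y: "Y \<in> sign_graphs n"
    have m: "Y $$ (i, j) = - 1" if "i < n" "j < n" "i \<noteq> j" "Y $$ (i, j) \<noteq> 1" for i j
      using Y that unfolding sign_graphs_def by blast
    have d: "Y $$ (i, i) = 0" if "i < n" for i
      using Y that unfolding sign_graphs_def by blast
    show "sign_graph n {(i, j) \<in> edges n. Y $$ (i, j) = 1} = Y"
    proof (rule eq_matI)
      fix i j assume "i < dim_row Y" "j < dim_col Y"
      then have ij: "i < n" "j < n" using Y by (auto simp: sign_graphs_def)
      show "sign_graph n {(i, j) \<in> edges n. Y $$ (i, j) = 1} $$ (i, j) = Y $$ (i, j)"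
        using ij m[OF ij] sign_graphs_sym[OF Y ij] d[of i]
        by (auto simp: sign_graph_def edges_def edge_sign_def min_def max_def)
    qed (use Y in \<open>auto simp: sign_graphs_def sign_graph_def\<close>)
  qed
  show "sign_graph n ` Pow (edges n) \<subseteq> sign_graphs n"
    by (auto simp: sign_graph_def sign_graphs_def edge_sign_def min_def max_def intro!: eq_matI)
qed auto

lemma sum_sign_graphs:
  fixes F :: "real mat \<Rightarrow> real"
  shows "(\<Sum>Y\<in>sign_graphs n. F Y) = (\<Sum>A\<in>Pow (edges n). F (sign_graph n A))"
  by (rule sum.reindex_bij_betw[OF bij_betw_sign_graph, symmetric])

lemma node_degree_sign_graph:
  "node_degree (sign_graph n A) i
    = (\<Sum>j<n. if i = j then 0 else edge_sign A (min i j, max i j))" if "i < n"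
  using that by (simp add: node_degree_def sign_graph_def)

lemma sum_node_degree:
  fixes a :: "nat \<Rightarrow> real"
  shows "(\<Sum>i<n. a i * node_degree (sign_graph n A) i)
           = (\<Sum>(i, j)\<in>edges n. (a i + a j) * edge_sign A (i, j))"
proof -
  have "(\<Sum>i<n. a i * node_degree (sign_graph n A) i)
      = (\<Sum>i<n. \<Sum>j<n. a i * (if i = j then 0 else edge_sign A (min i j, max i j)))"
    by (intro sum.cong) (simp_all add: node_degree_sign_graph sum_distrib_left)
  also have "\<dots> = (\<Sum>(i, j)\<in>edges n. (a i + a j) * edge_sign A (i, j))"
    unfolding sum_square_edges
    by (simp, intro sum.cong) (auto simp: edges_def min_def max_def algebra_simps)
  finally show ?thesis .
qed

text \<open>An exponent linear in the degrees is linear in the free edge signs, so the sum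
  factorizes over the edges. Expanding the product decides, edge by edge, about membership in
  \<open>A\<close>.\<close>

lemma sum_exp_node_degree:
  fixes a :: "nat \<Rightarrow> real"
  shows "(\<Sum>Y\<in>sign_graphs n. exp (\<Sum>i<n. a i * node_degree Y i))
           = (\<Prod>(i, j)\<in>edges n. 2 * cosh (a i + a j))"
proof -
  have "(\<Prod>(i, j)\<in>edges n. 2 * cosh (a i + a j))
      = (\<Prod>e\<in>edges n. exp (a (fst e) + a (snd e)) + exp (- (a (fst e) + a (snd e))))"
    by (intro prod.cong) (auto simp: cosh_def scaleR_conv_of_real field_simps)
  also have "\<dots> = (\<Sum>A\<in>Pow (edges n). (\<Prod>e\<in>A. exp (a (fst e) + a (snd e)))
                       * (\<Prod>e\<in>edges n - A. exp (- (a (fst e) + a (snd e)))))"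
    by (rule prod_add) simp
  also have "\<dots> = (\<Sum>A\<in>Pow (edges n). exp (\<Sum>i<n. a i * node_degree (sign_graph n A) i))"
  proof (rule sum.cong[OF refl])
    fix A assume A: "A \<in> Pow (edges n)"
    then have fin: "finite A" using finite_subset[OF _ finite_edges] by blast
    have "(\<Sum>(i, j)\<in>edges n. (a i + a j) * edge_sign A (i, j))
        = (\<Sum>e\<in>A. a (fst e) + a (snd e)) + (\<Sum>e\<in>edges n - A. - (a (fst e) + a (snd e)))"
      unfolding case_prod_unfold using A
      by (subst sum.subset_diff[of A]) (auto simp: edge_sign_def add.commute intro!: arg_cong2[where f = plus] sum.cong)
    then show "(\<Prod>e\<in>A. exp (a (fst e) + a (snd e))) * (\<Prod>e\<in>edges n - A. exp (- (a (fst e) + a (snd e))))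
        = exp (\<Sum>i<n. a i * node_degree (sign_graph n A) i)"
      using fin by (simp only: sum_node_degree exp_add exp_sum finite_edges finite_Diff)
  qed
  finally show ?thesis by (simp add: sum_sign_graphs)
qed

section \<open>Stochastic monotonicity in the degree parameters\<close>

text \<open>The four functions inequality on a one-element set. With X = c1 * d0 both mixed products
  are at most X, so (X - a0 * b1) * (X - a1 * b0) is nonnegative and bounds X times their sum by X *
  X plus their product. The result factors after multiplication by X; if X = 0, both mixed products
  vanish.\<close>

lemma ahlswede_daykin_base:
  fixes a0 a1 b0 b1 c0 c1 d0 d1 :: real
  assumes nn: "0 \<le> a0" "0 \<le> a1" "0 \<le> b0" "0 \<le> b1" "0 \<le> c0" "0 \<le> c1" "0 \<le> d0" "0 \<le> d1"
    and "a0 * b0 \<le> c0 * d0" "a0 * b1 \<le> c1 * d0" "a1 * b0 \<le> c1 * d0" "a1 * b1 \<le> c1 * d1"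
  shows "(a0 + a1) * (b0 + b1) \<le> (c0 + c1) * (d0 + d1)"
proof (cases "c1 * d0 = 0")
  case True
  then have X: "a0 * b1 = 0" "a1 * b0 = 0" "c1 * d0 = 0"
    using assms by (metis mult_nonneg_nonneg order_antisym)+
  moreover have "0 \<le> c0 * d1" using nn by simp
  moreover have "a0 * b0 \<le> c0 * d0" "a1 * b1 \<le> c1 * d1" by fact+
  ultimately show ?thesis unfolding ring_distribs using X by linarith
next
  case False
  define X where "X = c1 * d0"
  have X: "0 < X" using False nn unfolding X_def by (metis less_eq_real_def mult_nonneg_nonneg)
  have "X * ((a0 + a1) * (b0 + b1))
      = X * (a0 * b0 + a1 * b1) + X * (a0 * b1 + a1 * b0)"
    by (simp add: algebra_simps)
  also have "\<dots> \<le> X * (a0 * b0 + a1 * b1) + (X * X + (a0 * b1) * (a1 * b0))"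
    using mult_nonneg_nonneg[of "X - a0 * b1" "X - a1 * b0"] assms unfolding X_def[symmetric]
    by (simp add: algebra_simps)
  also have "\<dots> = (a0 * b0 + X) * (X + a1 * b1)" by (simp add: algebra_simps)
  also have "\<dots> \<le> (c0 * d0 + X) * (X + c1 * d1)"
    using assms X by (intro mult_mono[of "_ + X"] add_mono) auto
  also have "\<dots> = X * ((c0 + c1) * (d0 + d1))" unfolding X_def by (simp add: algebra_simps)
  finally show ?thesis using X by (simp only: mult_le_cancel_left_pos)
qed

text \<open>Summing out one element \<open>e\<close> turns each function into f A + f (insert e A)
  on the subsets of \<open>E\<close>; the one-element case says that the hypothesis survives
  this.\<close>

theorem ahlswede_daykin:
  fixes f1 f2 f3 f4 :: "'a set \<Rightarrow> real"
  assumes "finite E"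
    and "\<And>A. A \<subseteq> E \<Longrightarrow> 0 \<le> f1 A" "\<And>A. A \<subseteq> E \<Longrightarrow> 0 \<le> f2 A"
        "\<And>A. A \<subseteq> E \<Longrightarrow> 0 \<le> f3 A" "\<And>A. A \<subseteq> E \<Longrightarrow> 0 \<le> f4 A"
    and "\<And>A B. A \<subseteq> E \<Longrightarrow> B \<subseteq> E \<Longrightarrow> f1 A * f2 B \<le> f3 (A \<union> B) * f4 (A \<inter> B)"
  shows "(\<Sum>A\<in>Pow E. f1 A) * (\<Sum>A\<in>Pow E. f2 A) \<le> (\<Sum>A\<in>Pow E. f3 A) * (\<Sum>A\<in>Pow E. f4 A)"
  using assms
proof (induction E arbitrary: f1 f2 f3 f4 rule: finite_induct)
  case empty
  then show ?case by (metis (no_types, lifting) Int_absorb Pow_empty Un_absorb empty_subsetI finite.emptyI sum.empty sum.insert_remove add.right_neutral Diff_empty sum_clauses(2) empty_iff)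
next
  case (insert e E)
  have split: "(\<Sum>A\<in>Pow (insert e E). f A) = (\<Sum>A\<in>Pow E. f A + f (insert e A))" for f :: "'a set \<Rightarrow> real"
  proof -
    have inj: "inj_on (insert e) (Pow E)" using insert.hyps by (auto simp: inj_on_def)
    have "(\<Sum>A\<in>Pow (insert e E). f A) = (\<Sum>A\<in>Pow E. f A) + (\<Sum>A\<in>insert e ` Pow E. f A)"
      unfolding Pow_insert using insert.hyps by (intro sum.union_disjoint) auto
    then show ?thesis by (simp add: sum.reindex[OF inj] sum.distrib)
  qed
  have eq: "insert e A \<union> insert e B = insert e (A \<union> B)" "A \<union> insert e B = insert e (A \<union> B)"
      "insert e A \<union> B = insert e (A \<union> B)" "insert e A \<inter> insert e B = insert e (A \<inter> B)" for A B
    by auto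
  have eq2: "A \<inter> insert e B = A \<inter> B" "insert e A \<inter> B = A \<inter> B" if "A \<subseteq> E" "B \<subseteq> E" for A B
    using that insert.hyps by auto
  note nn = insert.prems(1-4) and le = insert.prems(5)
  show ?case unfolding split
  proof (rule insert.IH)
    fix A B assume AB: "A \<subseteq> E" "B \<subseteq> E"
    then have *: "A \<subseteq> insert e E" "B \<subseteq> insert e E" "insert e A \<subseteq> insert e E" "insert e B \<subseteq> insert e E"
      "A \<union> B \<subseteq> insert e E" "A \<inter> B \<subseteq> insert e E"
      "insert e (A \<union> B) \<subseteq> insert e E" "insert e (A \<inter> B) \<subseteq> insert e E" by auto
    show "(f1 A + f1 (insert e A)) * (f2 B + f2 (insert e B))
        \<le> (f3 (A \<union> B) + f3 (insert e (A \<union> B))) * (f4 (A \<inter> B) + f4 (insert e (A \<inter> B)))"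
      using le[OF *(1,2)] le[OF *(1,4)] le[OF *(3,2)] le[OF *(3,4)]
      by (intro ahlswede_daykin_base) (simp_all add: nn * eq eq2[OF AB])
  qed (auto intro!: add_nonneg_nonneg nn)
qed

lemma ergm_weight_pos [simp]: "0 < ergm_weight n \<theta> \<beta> Y"
  by (simp add: ergm_weight_def)

lemma prob_ergm:
  "measure_pmf.prob (ergm n \<theta> \<beta>) {Y. P Y}
     = (\<Sum>Y | Y \<in> sign_graphs n \<and> P Y. ergm_weight n \<theta> \<beta> Y) / ergm_Z n \<theta> \<beta>"
proof -
  have set: "set_pmf (ergm n \<theta> \<beta>) = sign_graphs n"
    using ergm_Z_pos[of n \<theta> \<beta>] by (auto simp: set_pmf_eq pmf_ergm less_imp_neq[symmetric])
  have "measure_pmf.prob (ergm n \<theta> \<beta>) {Y. P Y}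
      = measure_pmf.prob (ergm n \<theta> \<beta>) ({Y. P Y} \<inter> sign_graphs n)"
    by (metis measure_Int_set_pmf set)
  also have "\<dots> = (\<Sum>Y\<in>{Y. P Y} \<inter> sign_graphs n. pmf (ergm n \<theta> \<beta>) Y)"
    by (rule measure_measure_pmf_finite) (simp add: finite_sign_graphs)
  also have "\<dots> = (\<Sum>Y | Y \<in> sign_graphs n \<and> P Y. ergm_weight n \<theta> \<beta> Y / ergm_Z n \<theta> \<beta>)"
    by (rule sum.cong) (auto simp: pmf_ergm)
  finally show ?thesis by (simp add: sum_divide_distrib)
qed

lemma node_degree_Un_Int:
  assumes "i < n"
  shows "node_degree (sign_graph n A) i + node_degree (sign_graph n B) i
    = node_degree (sign_graph n (A \<union> B)) i + node_degree (sign_graph n (A \<inter> B)) i"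
  unfolding node_degree_sign_graph[OF assms] sum.distrib[symmetric]
  by (intro sum.cong) (auto simp: edge_sign_def)

lemma node_degree_mono:
  assumes "i < n" "A \<subseteq> B"
  shows "node_degree (sign_graph n A) i \<le> node_degree (sign_graph n B) i"
  unfolding node_degree_sign_graph[OF assms(1)]
  using assms(2) by (intro sum_mono) (auto simp: edge_sign_def)

text \<open>The pair (q, p) has the same sum but is more spread out; the two sides differ by 2 * (a
  - p) * (b - p).\<close>

lemma add_power2_le_of_majorized:
  fixes a b p q :: real
  assumes "a + b = q + p" "p \<le> a" "p \<le> b"
  shows "a\<^sup>2 + b\<^sup>2 \<le> q\<^sup>2 + p\<^sup>2"
proof -
  have q: "q = a + b - p" using assms by simp
  have "0 \<le> 2 * ((a - p) * (b - p))" using assms by simp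
  then show ?thesis by (simp add: q power2_eq_square algebra_simps)
qed

text \<open>Degrees are modular and increasing in the edge set, so their squares are supermodular.
  The larger parameter belongs to the union, because the degree gained there is then multiplied by
  the larger coefficient.\<close>

lemma ergm_weight_supermodular:
  assumes \<theta>: "0 \<le> \<theta>" and n: "0 < n" and le: "\<And>i. i < n \<Longrightarrow> \<beta>' $ i \<le> \<beta> $ i"
  shows "ergm_weight n \<theta> \<beta> (sign_graph n A) * ergm_weight n \<theta> \<beta>' (sign_graph n B)
    \<le> ergm_weight n \<theta> \<beta> (sign_graph n (A \<union> B)) * ergm_weight n \<theta> \<beta>' (sign_graph n (A \<inter> B))"
proof -
  define k where "k A i = node_degree (sign_graph n A) i" for A i
  have modular: "k A i + k B i = k (A \<union> B) i + k (A \<inter> B) i" if "i < n" for i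
    unfolding k_def using that by (rule node_degree_Un_Int)
  have le_k: "k (A \<inter> B) i \<le> k A i" "k (A \<inter> B) i \<le> k B i" if "i < n" for i
    unfolding k_def using that by (auto intro: node_degree_mono)
  have "(\<Sum>i<n. (k A i)\<^sup>2) + (\<Sum>i<n. (k B i)\<^sup>2) \<le> (\<Sum>i<n. (k (A \<union> B) i)\<^sup>2) + (\<Sum>i<n. (k (A \<inter> B) i)\<^sup>2)"
    unfolding sum.distrib[symmetric]
    by (intro sum_mono add_power2_le_of_majorized) (simp_all add: modular le_k)
  \<comment> \<open>For n = 1 this quotient is 0 by the convention for division by zero.\<close>
  moreover have "0 \<le> \<theta> / (real n - 1)" using \<theta> n by (intro divide_nonneg_nonneg) auto
  ultimately have 1: "\<theta> / (real n - 1) * (1 / 2 * ((\<Sum>i<n. (k A i)\<^sup>2) + (\<Sum>i<n. (k B i)\<^sup>2)) - real n * (real n - 1))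
      \<le> \<theta> / (real n - 1) * (1 / 2 * ((\<Sum>i<n. (k (A \<union> B) i)\<^sup>2) + (\<Sum>i<n. (k (A \<inter> B) i)\<^sup>2)) - real n * (real n - 1))"
    by (intro mult_left_mono) simp_all
  have 2: "(\<Sum>i<n. \<beta> $ i * k A i) + (\<Sum>i<n. \<beta>' $ i * k B i)
      \<le> (\<Sum>i<n. \<beta> $ i * k (A \<union> B) i) + (\<Sum>i<n. \<beta>' $ i * k (A \<inter> B) i)"
    unfolding sum.distrib[symmetric]
  proof (rule sum_mono)
    fix i assume "i \<in> {..<n}"
    then have i: "i < n" by simp
    have "\<beta>' $ i * (k B i - k (A \<inter> B) i) \<le> \<beta> $ i * (k B i - k (A \<inter> B) i)"
      using le[OF i] le_k[OF i] by (intro mult_right_mono) auto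
    also have "k B i - k (A \<inter> B) i = k (A \<union> B) i - k A i" using modular[OF i] by simp
    finally show "\<beta> $ i * k A i + \<beta>' $ i * k B i \<le> \<beta> $ i * k (A \<union> B) i + \<beta>' $ i * k (A \<inter> B) i"
      using arg_cong[OF modular[OF i], of "\<lambda>x. \<beta>' $ i * x"] by (simp add: algebra_simps)
  qed
  show ?thesis
    unfolding ergm_weight_def k_def[symmetric] exp_add[symmetric] exp_le_cancel_iff
    using 1 2 by (simp add: algebra_simps)
qed

lemma prob_total_degree_antimono:
  assumes \<theta>: "0 \<le> \<theta>" and n: "0 < n" and le: "\<And>i. i < n \<Longrightarrow> \<beta>' $ i \<le> \<beta> $ i"
  shows "measure_pmf.prob (ergm n \<theta> \<beta>) {Y. (\<Sum>i<n. node_degree Y i) \<le> L}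
    \<le> measure_pmf.prob (ergm n \<theta> \<beta>') {Y. (\<Sum>i<n. node_degree Y i) \<le> L}"
proof -
  define I where "I A = (of_bool ((\<Sum>i<n. node_degree (sign_graph n A) i) \<le> L) :: real)" for A
  define w where "w \<beta> A = ergm_weight n \<theta> \<beta> (sign_graph n A)" for \<beta> A
  have event: "(\<Sum>Y | Y \<in> sign_graphs n \<and> (\<Sum>i<n. node_degree Y i) \<le> L. ergm_weight n \<theta> \<beta> Y)
      = (\<Sum>A\<in>Pow (edges n). w \<beta> A * I A)" for \<beta>
  proof -
    have "(\<Sum>Y | Y \<in> sign_graphs n \<and> (\<Sum>i<n. node_degree Y i) \<le> L. ergm_weight n \<theta> \<beta> Y)
        = (\<Sum>Y\<in>sign_graphs n. ergm_weight n \<theta> \<beta> Y * of_bool ((\<Sum>i<n. node_degree Y i) \<le> L))"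
      by (intro sum.mono_neutral_cong_left) (auto simp: finite_sign_graphs)
    then show ?thesis by (simp add: sum_sign_graphs w_def I_def)
  qed
  have Z: "ergm_Z n \<theta> \<beta> = (\<Sum>A\<in>Pow (edges n). w \<beta> A)" for \<beta>
    by (simp add: ergm_Z_def sum_sign_graphs w_def)
  have "(\<Sum>A\<in>Pow (edges n). w \<beta> A * I A) * (\<Sum>A\<in>Pow (edges n). w \<beta>' A)
      \<le> (\<Sum>A\<in>Pow (edges n). w \<beta> A) * (\<Sum>A\<in>Pow (edges n). w \<beta>' A * I A)"
  \<comment> \<open>The event is decreasing in the edge set, so its indicator passes from
    \<open>A\<close> to \<open>A \<inter> B\<close>. It therefore accompanies the first and the
    fourth function.\<close>
  proof (rule ahlswede_daykin)
    fix A B assume "A \<subseteq> edges n" "B \<subseteq> edges n"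
    have "(\<Sum>i<n. node_degree (sign_graph n (A \<inter> B)) i) \<le> (\<Sum>i<n. node_degree (sign_graph n A) i)"
      by (intro sum_mono node_degree_mono) auto
    then have 1: "I A \<le> I (A \<inter> B)" by (auto simp: I_def)
    have 2: "w \<beta> A * w \<beta>' B \<le> w \<beta> (A \<union> B) * w \<beta>' (A \<inter> B)"
      unfolding w_def by (rule ergm_weight_supermodular[OF \<theta> n le])
    have "w \<beta> A * w \<beta>' B * I A \<le> w \<beta> (A \<union> B) * w \<beta>' (A \<inter> B) * I (A \<inter> B)"
      by (rule mult_mono[OF 2 1]) (auto simp: w_def I_def less_imp_le)
    then show "w \<beta> A * I A * w \<beta>' B \<le> w \<beta> (A \<union> B) * (w \<beta>' (A \<inter> B) * I (A \<inter> B))"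
      by (simp add: mult_ac)
  qed (auto simp: w_def I_def less_imp_le)
  then show ?thesis
    using ergm_Z_pos[of n \<theta> \<beta>] ergm_Z_pos[of n \<theta> \<beta>']
    by (simp add: prob_ergm event Z[symmetric] field_simps)
qed

section \<open>Chernoff bounds by shifting the degree parameters\<close>

lemma ergm_weight_shift:
  "ergm_weight n \<theta> (vec n (\<lambda>i. \<beta> $ i + 2 * u)) Y
     = ergm_weight n \<theta> \<beta> Y * exp (u * (\<Sum>i<n. node_degree Y i))"
proof -
  have "(\<Sum>i<n. vec n (\<lambda>i. \<beta> $ i + 2 * u) $ i * node_degree Y i)
      = (\<Sum>i<n. \<beta> $ i * node_degree Y i) + 2 * u * (\<Sum>i<n. node_degree Y i)"
    by (simp add: sum_distrib_left sum.distrib[symmetric] algebra_simps)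
  then show ?thesis
    unfolding ergm_weight_def exp_add[symmetric] by (simp add: algebra_simps)
qed

text \<open>The sign of \<open>u\<close> is left open so that one statement covers both tails. The
  shift is 2 * u because the linear term of the model carries a factor 1/2.\<close>

lemma ergm_chernoff:
  assumes "\<And>Y. P Y \<Longrightarrow> 0 \<le> u * ((\<Sum>i<n. node_degree Y i) - L)"
  shows "measure_pmf.prob (ergm n \<theta> \<beta>) {Y. P Y}
    \<le> exp (- (u * L)) * ergm_Z n \<theta> (vec n (\<lambda>i. \<beta> $ i + 2 * u)) / ergm_Z n \<theta> \<beta>"
proof -
  have "(\<Sum>Y | Y \<in> sign_graphs n \<and> P Y. ergm_weight n \<theta> \<beta> Y)
      \<le> (\<Sum>Y\<in>sign_graphs n. exp (- (u * L)) * ergm_weight n \<theta> (vec n (\<lambda>i. \<beta> $ i + 2 * u)) Y)"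
  proof (rule sum_mono2[THEN order_trans[rotated]])
    show "(\<Sum>Y | Y \<in> sign_graphs n \<and> P Y. ergm_weight n \<theta> \<beta> Y)
        \<le> (\<Sum>Y | Y \<in> sign_graphs n \<and> P Y. exp (- (u * L)) * ergm_weight n \<theta> (vec n (\<lambda>i. \<beta> $ i + 2 * u)) Y)"
    proof (rule sum_mono)
      fix Y assume "Y \<in> {Y. Y \<in> sign_graphs n \<and> P Y}"
      then have "1 \<le> exp (u * ((\<Sum>i<n. node_degree Y i) - L))" using assms by simp
      then have "ergm_weight n \<theta> \<beta> Y * 1 \<le> ergm_weight n \<theta> \<beta> Y * exp (u * ((\<Sum>i<n. node_degree Y i) - L))"
        by (intro mult_left_mono) (auto simp: less_imp_le)
      also have "exp (u * ((\<Sum>i<n. node_degree Y i) - L)) = exp (u * (\<Sum>i<n. node_degree Y i)) * exp (- (u * L))"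
        by (simp add: mult_exp_exp algebra_simps)
      finally show "ergm_weight n \<theta> \<beta> Y \<le> exp (- (u * L)) * ergm_weight n \<theta> (vec n (\<lambda>i. \<beta> $ i + 2 * u)) Y"
        unfolding ergm_weight_shift by (simp only: mult_ac)
    qed
  qed (auto simp: finite_sign_graphs less_imp_le)
  then show ?thesis
    unfolding prob_ergm using ergm_Z_pos[of n \<theta> \<beta>]
    by (simp add: divide_right_mono ergm_Z_def[of n \<theta> "vec n _"] sum_distrib_left)
qed

section \<open>Permutation symmetry and convexity of the partition function\<close>

lemma bij_betw_add_mod: "bij_betw (\<lambda>r. (i + r) mod n) {..<n} {..<n :: nat}"
proof (cases "n = 0")
  case False
  have "inj_on (\<lambda>r. (i + r) mod n) {..<n}"
  proof (rule inj_onI)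
    fix r r' assume *: "r \<in> {..<n}" "r' \<in> {..<n}" "(i + r) mod n = (i + r') mod n"
    then have "int n dvd int r - int r'"
      by (metis add_diff_cancel_left mod_eq_dvd_iff of_nat_add zmod_int)
    with * show "r = r'"
      using zdvd_imp_le[of "int n" "int r - int r'"] zdvd_imp_le[of "int n" "int r' - int r"]
      by (cases r r' rule: linorder_cases) (auto simp: dvd_diff_commute)
  qed
  moreover have "(\<lambda>r. (i + r) mod n) ` {..<n} \<subseteq> {..<n}" using False by auto
  ultimately show ?thesis by (simp add: bij_betw_def endo_inj_surj)
qed auto

definition permute_graph :: "nat \<Rightarrow> (nat \<Rightarrow> nat) \<Rightarrow> real mat \<Rightarrow> real mat" where
  "permute_graph n p Y = mat n n (\<lambda>(i, j). Y $$ (p i, p j))"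

lemma bij_betw_permute_graph:
  assumes "bij_betw p {..<n} {..<n}"
  shows "bij_betw (permute_graph n p) (sign_graphs n) (sign_graphs n)"
proof -
  have p: "p i < n" if "i < n" for i using assms that by (auto simp: bij_betw_def)
  have inj: "p i = p j \<longleftrightarrow> i = j" if "i < n" "j < n" for i j
    using assms that by (auto simp: bij_betw_def inj_on_def)
  have "permute_graph n p ` sign_graphs n \<subseteq> sign_graphs n"
  proof
    fix Y' assume "Y' \<in> permute_graph n p ` sign_graphs n"
    then obtain Y where Y: "Y \<in> sign_graphs n" "Y' = permute_graph n p Y" by auto
    show "Y' \<in> sign_graphs n"
      using Y(1) p sign_graphs_sym[OF Y(1)] unfolding Y(2)
      by (auto simp: sign_graphs_def permute_graph_def inj intro!: eq_matI)
  qed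
  moreover have "inj_on (permute_graph n p) (sign_graphs n)"
  proof (rule inj_onI)
    fix X Y assume X: "X \<in> sign_graphs n" and Y: "Y \<in> sign_graphs n"
      and eq: "permute_graph n p X = permute_graph n p Y"
    show "X = Y"
    proof (rule eq_matI)
      fix i j assume "i < dim_row Y" "j < dim_col Y"
      then have "i < n" "j < n" using Y by (auto simp: sign_graphs_def)
      then obtain i' j' where ij: "i' < n" "j' < n" "i = p i'" "j = p j'"
        using assms unfolding bij_betw_def by (metis imageE lessThan_iff)
      have "permute_graph n p X $$ (i', j') = permute_graph n p Y $$ (i', j')" using eq by simp
      then show "X $$ (i, j) = Y $$ (i, j)" using ij by (simp add: permute_graph_def)
    qed (use X Y in \<open>auto simp: sign_graphs_def\<close>)
  qed
  ultimately show ?thesis by (simp add: bij_betw_def endo_inj_surj finite_sign_graphs)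
qed

lemma node_degree_permute_graph:
  assumes "bij_betw p {..<n} {..<n}" "Y \<in> sign_graphs n" "i < n"
  shows "node_degree (permute_graph n p Y) i = node_degree Y (p i)"
proof -
  have "node_degree (permute_graph n p Y) i = (\<Sum>j<n. Y $$ (p i, p j))"
    using assms(3) by (simp add: node_degree_def permute_graph_def)
  also have "\<dots> = (\<Sum>j<n. Y $$ (p i, j))" by (rule sum.reindex_bij_betw[OF assms(1)])
  finally show ?thesis using assms(2) by (auto simp: node_degree_def sign_graphs_def)
qed

lemma ergm_Z_permute:
  assumes p: "bij_betw p {..<n} {..<n}"
  shows "ergm_Z n \<theta> (vec n (\<lambda>i. \<beta> (p i))) = ergm_Z n \<theta> (vec n \<beta>)"
proof -
  have "ergm_weight n \<theta> (vec n (\<lambda>i. \<beta> (p i))) (permute_graph n p Y) = ergm_weight n \<theta> (vec n \<beta>) Y"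
    if Y: "Y \<in> sign_graphs n" for Y
  proof -
    have pn: "i < n \<Longrightarrow> p i < n" for i using p by (auto simp: bij_betw_def)
    have "(\<Sum>i<n. (node_degree (permute_graph n p Y) i)\<^sup>2) = (\<Sum>i<n. (node_degree Y (p i))\<^sup>2)"
      using node_degree_permute_graph[OF p Y] by simp
    also have "\<dots> = (\<Sum>i<n. (node_degree Y i)\<^sup>2)" by (rule sum.reindex_bij_betw[OF p])
    finally have 1: "(\<Sum>i<n. (node_degree (permute_graph n p Y) i)\<^sup>2) = (\<Sum>i<n. (node_degree Y i)\<^sup>2)" .
    have "(\<Sum>i<n. vec n (\<lambda>i. \<beta> (p i)) $ i * node_degree (permute_graph n p Y) i)
        = (\<Sum>i<n. vec n \<beta> $ p i * node_degree Y (p i))"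
      using node_degree_permute_graph[OF p Y] pn by simp
    also have "\<dots> = (\<Sum>i<n. vec n \<beta> $ i * node_degree Y i)" by (rule sum.reindex_bij_betw[OF p])
    finally show ?thesis unfolding ergm_weight_def 1 by simp
  qed
  then show ?thesis
    unfolding ergm_Z_def
    by (subst sum.reindex_bij_betw[OF bij_betw_permute_graph[OF p], symmetric]) simp
qed

text \<open>Averaging over the cyclic shifts of the vertices and Jensen's inequality for the exponential,
  in the form of its tangent line.\<close>

lemma ergm_Z_mean_le:
  assumes n: "0 < n"
  shows "ergm_Z n \<theta> (vec n (\<lambda>_. (\<Sum>i<n. \<beta> i) / n)) \<le> ergm_Z n \<theta> (vec n \<beta>)"
proof -
  define m where "m = (\<Sum>i<n. \<beta> i) / n"
  define k where "k Y i = node_degree Y i" for Y i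
  define w where "w Y = exp (\<theta> / (real n - 1) * (1 / 2 * (\<Sum>i<n. (k Y i)\<^sup>2) - real n * (real n - 1) / 2))" for Y
  define x where "x Y r = 1 / 2 * (\<Sum>i<n. \<beta> ((r + i) mod n) * k Y i)" for Y r
  define y where "y Y = 1 / 2 * (\<Sum>i<n. m * k Y i)" for Y
  have avg: "(\<Sum>r<n. x Y r) = n * y Y" for Y
  proof -
    have "(\<Sum>r<n. x Y r) = (1 / 2) * (\<Sum>i<n. \<Sum>r<n. \<beta> ((i + r) mod n) * k Y i)"
      unfolding x_def sum_distrib_left[symmetric] by (subst sum.swap) (simp add: add.commute)
    also have "\<dots> = (1 / 2) * (\<Sum>i<n. (\<Sum>j<n. \<beta> j) * k Y i)"
      by (simp add: sum_distrib_right[symmetric] sum.reindex_bij_betw[OF bij_betw_add_mod])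
    finally show ?thesis using n by (simp add: y_def m_def sum_distrib_left)
  qed
  have "n * ergm_Z n \<theta> (vec n (\<lambda>_. m)) = (\<Sum>Y\<in>sign_graphs n. n * (w Y * exp (y Y)))"
    by (simp add: ergm_Z_def ergm_weight_def w_def y_def k_def exp_add sum_distrib_left)
  \<comment> \<open>The tangent touches at \<open>y Y\<close>, the average of \<open>x Y r\<close>
    over the shifts, so the linear terms cancel in the sum over \<open>r\<close>.\<close>
  also have "\<dots> = (\<Sum>Y\<in>sign_graphs n. \<Sum>r<n. w Y * (exp (y Y) * (1 + (x Y r - y Y))))"
  proof (rule sum.cong[OF refl])
    fix Y
    have "(\<Sum>r<n. w Y * (exp (y Y) * (1 + (x Y r - y Y))))
        = w Y * (exp (y Y) * (\<Sum>r<n. 1 + (x Y r - y Y)))"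
      by (simp only: sum_distrib_left)
    also have "(\<Sum>r<n. 1 + (x Y r - y Y)) = n"
      by (simp add: sum.distrib sum_subtractf avg)
    finally show "n * (w Y * exp (y Y)) = (\<Sum>r<n. w Y * (exp (y Y) * (1 + (x Y r - y Y))))"
      by simp
  qed
  also have "\<dots> \<le> (\<Sum>Y\<in>sign_graphs n. \<Sum>r<n. w Y * exp (x Y r))"
  proof (intro sum_mono mult_left_mono)
    fix Y r
    have "exp (y Y) * (1 + (x Y r - y Y)) \<le> exp (y Y) * exp (x Y r - y Y)"
      by (intro mult_left_mono exp_ge_add_one_self) auto
    then show "exp (y Y) * (1 + (x Y r - y Y)) \<le> exp (x Y r)" by (simp add: mult_exp_exp)
  qed (simp add: w_def)
  also have "\<dots> = (\<Sum>r<n. ergm_Z n \<theta> (vec n (\<lambda>i. \<beta> ((r + i) mod n))))"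
    by (subst sum.swap) (simp add: ergm_Z_def ergm_weight_def w_def x_def k_def exp_add)
  also have "\<dots> = n * ergm_Z n \<theta> (vec n \<beta>)"
    using ergm_Z_permute[OF bij_betw_add_mod, where n = n and \<beta> = \<beta> and \<theta> = \<theta>] by simp
  finally show ?thesis using n by (simp add: m_def)
qed

section \<open>Sign symmetry and a lower bound for the risk\<close>

lemma bij_betw_uminus_sign_graphs: "bij_betw uminus (sign_graphs n) (sign_graphs n)"
proof -
  have sub: "uminus ` sign_graphs n \<subseteq> sign_graphs n"
  proof
    fix X assume "X \<in> uminus ` sign_graphs n"
    then obtain Y where Y: "Y \<in> sign_graphs n" "X = - Y" by auto
    then show "X \<in> sign_graphs n"
      using sign_graphs_sym[OF Y(1)] by (auto simp: sign_graphs_def intro!: eq_matI) blast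
  qed
  show ?thesis by (rule bij_betw_byWitness[where f' = uminus]) (use sub in auto)
qed

lemma node_degree_uminus: "Y \<in> sign_graphs n \<Longrightarrow> i < n \<Longrightarrow> node_degree (- Y) i = - node_degree Y i"
  by (auto simp: node_degree_def sign_graphs_def sum_negf)

text \<open>Flipping all signs preserves the null weight and negates the linear form, so the two
  closed half spaces have equal weight, and together they cover everything.\<close>

lemma half_ergm_Z_le:
  "ergm_Z n \<theta> (0\<^sub>v n) / 2
    \<le> (\<Sum>Y | Y \<in> sign_graphs n \<and> 0 \<le> (\<Sum>i<n. \<beta> i * node_degree Y i). ergm_weight n \<theta> (0\<^sub>v n) Y)"
    (is "_ \<le> ?S")
proof -
  define w where "w Y = ergm_weight n \<theta> (0\<^sub>v n) Y" for Y
  define x where "x Y = (\<Sum>i<n. \<beta> i * node_degree Y i)" for Y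
  have w: "w (- Y) = w Y" and x: "x (- Y) = - x Y" if "Y \<in> sign_graphs n" for Y
    using node_degree_uminus[OF that] by (simp_all add: w_def x_def ergm_weight_def sum_negf)
  have S: "?S = (\<Sum>Y\<in>sign_graphs n. w Y * of_bool (0 \<le> x Y))"
    unfolding w_def x_def by (intro sum.mono_neutral_cong_left) (auto simp: finite_sign_graphs)
  also have "\<dots> = (\<Sum>Y\<in>sign_graphs n. w (- Y) * of_bool (0 \<le> x (- Y)))"
    by (rule sum.reindex_bij_betw[OF bij_betw_uminus_sign_graphs, symmetric])
  also have "\<dots> = (\<Sum>Y\<in>sign_graphs n. w Y * of_bool (x Y \<le> 0))"
    by (intro sum.cong) (simp_all add: w x)
  finally have "2 * ?S = (\<Sum>Y\<in>sign_graphs n. w Y * of_bool (0 \<le> x Y)) + (\<Sum>Y\<in>sign_graphs n. w Y * of_bool (x Y \<le> 0))"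
    using S by simp
  also have "\<dots> \<ge> (\<Sum>Y\<in>sign_graphs n. w Y)"
    unfolding sum.distrib[symmetric] by (intro sum_mono) (auto simp: w_def less_imp_le)
  finally show ?thesis by (simp add: ergm_Z_def w_def)
qed

text \<open>On the half space where the tilt is at least 1, both laws dominate 1 / C times the null
  law. Whatever value the test takes at such a graph, this share is counted in one of the two
  errors.\<close>

lemma risk_lower_bound:
  assumes T: "is_test n T" and \<beta>: "\<beta> \<in> alternative n s A" and C: "1 \<le> C"
    and Z: "ergm_Z n \<theta> \<beta> \<le> C * ergm_Z n \<theta> (0\<^sub>v n)"
  shows "1 / (2 * C) \<le> risk n \<theta> s A T"
proof -
  define Z0 where "Z0 = ergm_Z n \<theta> (0\<^sub>v n)"
  define Z1 where "Z1 = ergm_Z n \<theta> \<beta>"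
  define x where "x Y = (\<Sum>i<n. \<beta> $ i * node_degree Y i)" for Y
  define w0 where "w0 = ergm_weight n \<theta> (0\<^sub>v n)"
  define w1 where "w1 = ergm_weight n \<theta> \<beta>"
  have Z0: "0 < Z0" and Z1: "0 < Z1" unfolding Z0_def Z1_def by (rule ergm_Z_pos)+
  have w0: "0 < w0 Y" and w1: "0 < w1 Y" for Y by (simp_all add: w0_def w1_def)
  have le: "w0 Y / Z0 / C \<le> w1 Y / Z1" if "0 \<le> x Y" for Y
  proof -
    have "w0 Y \<le> w1 Y" using that by (simp add: w0_def w1_def ergm_weight_def x_def)
    then have "w0 Y / (C * Z0) \<le> w1 Y / Z1"
      using Z Z0 Z1 w0[of Y] by (intro frac_le) (auto simp: Z0_def Z1_def less_imp_le)
    then show ?thesis by (simp add: mult.commute)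
  qed
  have le0: "w0 Y / Z0 / C \<le> w0 Y / Z0" for Y
    using C Z0 w0[of Y] by (simp add: divide_le_eq mult_le_cancel_left1)
  have fin: "finite {Y. Y \<in> sign_graphs n \<and> P Y}" for P using finite_sign_graphs by simp
  have "1 / (2 * C) = Z0 / 2 / Z0 / C" using Z0 by simp
  also have "\<dots> \<le> (\<Sum>Y | Y \<in> sign_graphs n \<and> 0 \<le> x Y. w0 Y) / Z0 / C"
    using half_ergm_Z_le[of n \<theta> "\<lambda>i. \<beta> $ i"] Z0 C
    by (intro divide_right_mono) (auto simp: Z0_def w0_def x_def)
  also have "\<dots> = (\<Sum>Y | Y \<in> sign_graphs n \<and> 0 \<le> x Y. w0 Y / Z0 / C)"
    by (simp add: sum_divide_distrib)
  also have "{Y. Y \<in> sign_graphs n \<and> 0 \<le> x Y}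
      = {Y. Y \<in> sign_graphs n \<and> 0 \<le> x Y \<and> T Y = 1} \<union> {Y. Y \<in> sign_graphs n \<and> 0 \<le> x Y \<and> T Y = 0}"
    using T by (auto simp: is_test_def)
  also have "(\<Sum>Y\<in>\<dots>. w0 Y / Z0 / C)
      = (\<Sum>Y | Y \<in> sign_graphs n \<and> 0 \<le> x Y \<and> T Y = 1. w0 Y / Z0 / C)
        + (\<Sum>Y | Y \<in> sign_graphs n \<and> 0 \<le> x Y \<and> T Y = 0. w0 Y / Z0 / C)"
    using fin by (intro sum.union_disjoint) auto
  also have "\<dots> \<le> (\<Sum>Y | Y \<in> sign_graphs n \<and> T Y = 1. w0 Y / Z0)
        + (\<Sum>Y | Y \<in> sign_graphs n \<and> T Y = 0. w1 Y / Z1)"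
  proof (intro add_mono)
    have "(\<Sum>Y | Y \<in> sign_graphs n \<and> 0 \<le> x Y \<and> T Y = 1. w0 Y / Z0 / C)
        \<le> (\<Sum>Y | Y \<in> sign_graphs n \<and> 0 \<le> x Y \<and> T Y = 1. w0 Y / Z0)"
      by (intro sum_mono le0)
    also have "\<dots> \<le> (\<Sum>Y | Y \<in> sign_graphs n \<and> T Y = 1. w0 Y / Z0)"
      using fin w0 Z0 by (intro sum_mono2) (auto simp: less_imp_le)
    finally show "(\<Sum>Y | Y \<in> sign_graphs n \<and> 0 \<le> x Y \<and> T Y = 1. w0 Y / Z0 / C)
        \<le> (\<Sum>Y | Y \<in> sign_graphs n \<and> T Y = 1. w0 Y / Z0)" .
    have "(\<Sum>Y | Y \<in> sign_graphs n \<and> 0 \<le> x Y \<and> T Y = 0. w0 Y / Z0 / C)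
        \<le> (\<Sum>Y | Y \<in> sign_graphs n \<and> 0 \<le> x Y \<and> T Y = 0. w1 Y / Z1)"
      by (intro sum_mono le) auto
    also have "\<dots> \<le> (\<Sum>Y | Y \<in> sign_graphs n \<and> T Y = 0. w1 Y / Z1)"
      using fin w1 Z1 by (intro sum_mono2) (auto simp: less_imp_le)
    finally show "(\<Sum>Y | Y \<in> sign_graphs n \<and> 0 \<le> x Y \<and> T Y = 0. w0 Y / Z0 / C)
        \<le> (\<Sum>Y | Y \<in> sign_graphs n \<and> T Y = 0. w1 Y / Z1)" .
  qed
  also have "\<dots> = measure_pmf.prob (ergm n \<theta> (0\<^sub>v n)) {Y. T Y = 1} + measure_pmf.prob (ergm n \<theta> \<beta>) {Y. T Y = 0}"
    by (simp add: prob_ergm sum_divide_distrib Z0_def Z1_def w0_def w1_def)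
  also have "\<dots> \<le> risk n \<theta> s A T"
    unfolding risk_def using \<beta> by (intro add_left_mono cSUP_upper bdd_aboveI2[where M = 1]) auto
  finally show ?thesis .
qed

section \<open>The gap between \<open>x\<^sup>2 / 2\<close> and \<open>ln (cosh x)\<close>\<close>

definition cosh_gap :: "real \<Rightarrow> real" where
  "cosh_gap x = x\<^sup>2 / 2 - ln (cosh x)"

lemma DERIV_cosh_gap: "(cosh_gap has_real_derivative x - tanh x) (at x)"
  unfolding cosh_gap_def [abs_def]
  by (auto intro!: derivative_eq_intros simp: tanh_def cosh_real_pos)

lemma DERIV_tanh: "(tanh has_real_derivative 1 - (tanh x)\<^sup>2) (at x)" for x :: real
  by (auto intro!: derivative_eq_intros simp: less_imp_neq[OF cosh_real_pos, symmetric])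

lemma tanh_le_self: "tanh x \<le> x" if "0 \<le> x" for x :: real
proof -
  have "0 - tanh 0 \<le> x - tanh x"
    by (rule DERIV_nonneg_imp_nondecreasing[OF that])
      (auto intro!: exI derivative_eq_intros DERIV_tanh)
  then show ?thesis by simp
qed

lemma tanh_power2_le: "(tanh x)\<^sup>2 \<le> x\<^sup>2" for x :: real
  using tanh_le_self[of "\<bar>x\<bar>"] power_mono[of "tanh \<bar>x\<bar>" "\<bar>x\<bar>" 2]
  by (cases "0 \<le> x") (auto simp: tanh_real_abs)

text \<open>The second derivative is the square of \<open>tanh\<close>, hence convexity. The tangent
  form yields both Jensen's inequality over the edges and linear lower bounds.\<close>

lemma cosh_gap_above_tangent:
  "cosh_gap m + (m - tanh m) * (x - m) \<le> cosh_gap x"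
proof -
  have "convex_on UNIV cosh_gap"
    by (rule f''_ge0_imp_convex[where f' = "\<lambda>x. x - tanh x" and f'' = "\<lambda>x. (tanh x)\<^sup>2"])
      (auto intro!: derivative_eq_intros DERIV_cosh_gap DERIV_tanh)
  then have "cosh_gap x - cosh_gap m \<ge> (m - tanh m) * (x - m)"
    by (rule convex_on_imp_above_tangent) (auto intro: DERIV_cosh_gap)
  then show ?thesis by simp
qed

lemma cosh_gap_nonneg: "0 \<le> cosh_gap x"
  using cosh_gap_above_tangent[of 0 x] by (simp add: cosh_gap_def)

lemma cosh_gap_minus [simp]: "cosh_gap (- x) = cosh_gap x"
  by (simp add: cosh_gap_def)

lemma cosh_gap_le: "cosh_gap x \<le> x ^ 4 / 12"
proof -
  have nonneg: "cosh_gap x \<le> x ^ 4 / 12" if "0 \<le> x" for x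
  proof -
    \<comment> \<open>The derivative of the gap is y - tanh y, so the bound tanh^2 z \<le> z^2 is
      integrated twice.\<close>
    have d: "0 \<le> y ^ 3 / 3 - y + tanh y" if "0 \<le> y" for y :: real
    proof -
      have "0 ^ 3 / 3 - 0 + tanh 0 \<le> y ^ 3 / 3 - y + tanh y"
      proof (rule DERIV_nonneg_imp_nondecreasing[OF that])
        fix z :: real
        have "((\<lambda>y. y ^ 3 / 3 - y + tanh y) has_real_derivative z\<^sup>2 - (tanh z)\<^sup>2) (at z)"
          by (auto intro!: derivative_eq_intros DERIV_tanh)
        then show "\<exists>d. ((\<lambda>y. y ^ 3 / 3 - y + tanh y) has_real_derivative d) (at z) \<and> 0 \<le> d"
          using tanh_power2_le[of z] by (intro exI[of _ "z\<^sup>2 - (tanh z)\<^sup>2"]) auto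
      qed
      then show ?thesis by simp
    qed
    have "(\<lambda>x. x ^ 4 / 12 - cosh_gap x) 0 \<le> (\<lambda>x. x ^ 4 / 12 - cosh_gap x) x"
    proof (rule DERIV_nonneg_imp_nondecreasing[OF that])
      fix y :: real assume "0 \<le> y"
      have "((\<lambda>y. y ^ 4 / 12 - cosh_gap y) has_real_derivative y ^ 3 / 3 - y + tanh y) (at y)"
        by (auto intro!: derivative_eq_intros DERIV_cosh_gap)
      then show "\<exists>d. ((\<lambda>y. y ^ 4 / 12 - cosh_gap y) has_real_derivative d) (at y) \<and> 0 \<le> d"
        using d[OF \<open>0 \<le> y\<close>] by (intro exI[of _ "y ^ 3 / 3 - y + tanh y"]) auto
    qed
    then show ?thesis by (simp add: cosh_gap_def)
  qed
  show ?thesis using nonneg[of x] nonneg[of "- x"] by (cases "0 \<le> x") auto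
qed

text \<open>The left-out part x - tanh x has derivative tanh^2. On the short interval the derivative
  of tanh is at least 1/2, so tanh y is at least y / 2, and integrating y^2 / 4 gives the
  cube.\<close>

lemma cube_le_self_minus_tanh:
  fixes x :: real
  assumes x: "0 \<le> x" "x \<le> 1 / 2"
  shows "x ^ 3 / 12 \<le> x - tanh x"
proof -
  have t: "y / 2 \<le> tanh y" if y: "0 \<le> y" "y \<le> 1 / 2" for y :: real
  proof -
    have "tanh 0 - 0 / 2 \<le> tanh y - y / 2"
    proof (rule DERIV_nonneg_imp_nondecreasing[OF y(1)])
      fix z :: real assume z: "0 \<le> z" "z \<le> y"
      have "((\<lambda>y. tanh y - y / 2) has_real_derivative 1 / 2 - (tanh z)\<^sup>2) (at z)"
        by (auto intro!: derivative_eq_intros DERIV_tanh)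
      moreover have "(tanh z)\<^sup>2 \<le> 1 / 2"
        using tanh_power2_le[of z] power_mono[of z "1 / 2" 2] z y by (simp add: power2_eq_square)
      ultimately show "\<exists>d. ((\<lambda>y. tanh y - y / 2) has_real_derivative d) (at z) \<and> 0 \<le> d"
        by (intro exI[of _ "1 / 2 - (tanh z)\<^sup>2"]) auto
    qed
    then show ?thesis by simp
  qed
  have "0 - tanh 0 - 0 ^ 3 / 12 \<le> x - tanh x - x ^ 3 / 12"
  proof (rule DERIV_nonneg_imp_nondecreasing[OF x(1)])
    fix y assume y: "0 \<le> y" "y \<le> x"
    have "((\<lambda>x. x - tanh x - x ^ 3 / 12) has_real_derivative (tanh y)\<^sup>2 - y\<^sup>2 / 4) (at y)"
      by (auto intro!: derivative_eq_intros DERIV_tanh)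
    moreover have "y\<^sup>2 / 4 \<le> (tanh y)\<^sup>2"
      using power_mono[OF t[of y], of 2] y x by (simp add: power_divide)
    ultimately show "\<exists>d. ((\<lambda>x. x - tanh x - x ^ 3 / 12) has_real_derivative d) (at y) \<and> 0 \<le> d"
      by (intro exI[of _ "(tanh y)\<^sup>2 - y\<^sup>2 / 4"]) auto
  qed
  then show ?thesis by simp
qed

text \<open>The tangent at \<open>y\<close> with its nonnegative height dropped. Keeping
  \<open>y\<close> free allows a tangent point that depends on n, and a linear bound suffices for
  integrability of the exponential.\<close>

lemma cosh_gap_ge_linear:
  assumes y: "0 \<le> y" "y \<le> 1 / 2"
  shows "y ^ 3 / 12 * (\<bar>x\<bar> - y) \<le> cosh_gap x"
proof (cases "\<bar>x\<bar> \<le> y")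
  case True
  then have "y ^ 3 / 12 * (\<bar>x\<bar> - y) \<le> 0" using y by (intro mult_nonneg_nonpos) auto
  then show ?thesis using cosh_gap_nonneg[of x] by simp
next
  case False
  have "y ^ 3 / 12 * (\<bar>x\<bar> - y) \<le> (y - tanh y) * (\<bar>x\<bar> - y)"
    using False cube_le_self_minus_tanh[OF y] by (intro mult_right_mono) auto
  also have "\<dots> \<le> cosh_gap \<bar>x\<bar>"
    using cosh_gap_above_tangent[of y "\<bar>x\<bar>"] cosh_gap_nonneg[of y] by simp
  also have "cosh_gap \<bar>x\<bar> = cosh_gap x" by (cases "0 \<le> x") auto
  finally show ?thesis .
qed

text \<open>Here 256 = 4^4, from |x| / 4 \<le> exp (|x| / 4).\<close>

lemma power4_le_exp: "x ^ 4 \<le> 256 * (exp x + exp (- x))" for x :: real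
proof -
  have "x ^ 4 / 256 = (\<bar>x\<bar> / 4) ^ 4" by (simp add: power_divide)
  also have "\<dots> \<le> exp (\<bar>x\<bar> / 4) ^ 4"
    using exp_ge_add_one_self[of "\<bar>x\<bar> / 4"] by (intro power_mono) linarith+
  also have "\<dots> = exp \<bar>x\<bar>" by (simp add: exp_of_nat_mult[symmetric])
  also have "\<dots> \<le> exp x + exp (- x)" by (cases "0 \<le> x") auto
  finally show ?thesis by simp
qed

lemma power4_add_le: "(x + y) ^ 4 \<le> 8 * (x ^ 4 + y ^ 4)" for x y :: real
proof -
  have sq: "(u + v)\<^sup>2 \<le> 2 * (u\<^sup>2 + v\<^sup>2)" for u v :: real
    using sum_squares_bound[of u v] by (simp add: power2_sum)
  note sq2 = sq[of "x\<^sup>2" "y\<^sup>2"]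
  have "(x + y) ^ 4 = ((x + y)\<^sup>2)\<^sup>2" by (simp add: power_mult[symmetric])
  also have "\<dots> \<le> (2 * (x\<^sup>2 + y\<^sup>2))\<^sup>2" using sq by (intro power_mono) auto
  also have "\<dots> = 4 * (x\<^sup>2 + y\<^sup>2)\<^sup>2" by (simp only: power_mult_distrib) simp
  also have "\<dots> \<le> 4 * (2 * ((x\<^sup>2)\<^sup>2 + (y\<^sup>2)\<^sup>2))" using sq2 by (rule mult_left_mono) simp
  also have "\<dots> = 8 * (x ^ 4 + y ^ 4)" by (simp add: power_mult[symmetric])
  finally show ?thesis .
qed

section \<open>Gaussian integrals over product spaces\<close>

text \<open>Translation by \<nu> reduces this to the centred case.\<close>

lemma conv_normal_density:
  assumes "0 < \<sigma>" "0 < \<tau>"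
  shows "(\<integral>\<^sup>+z. ennreal (normal_density \<mu> \<sigma> (w - z)) * ennreal (normal_density \<nu> \<tau> z) \<partial>lborel)
    = ennreal (normal_density (\<mu> + \<nu>) (sqrt (\<sigma>\<^sup>2 + \<tau>\<^sup>2)) w)"
proof -
  have "(\<integral>\<^sup>+z. ennreal (normal_density \<mu> \<sigma> (w - z)) * ennreal (normal_density \<nu> \<tau> z) \<partial>lborel)
      = (\<integral>\<^sup>+z. ennreal (normal_density \<mu> \<sigma> (w - (\<nu> + 1 * z))) * ennreal (normal_density \<nu> \<tau> (\<nu> + 1 * z)) \<partial>lborel)"
    by (subst nn_integral_real_affine[where c = 1 and t = \<nu>]) auto
  also have "\<dots> = (\<integral>\<^sup>+z. ennreal (normal_density 0 \<sigma> ((w - (\<mu> + \<nu>)) - z) * normal_density 0 \<tau> z) \<partial>lborel)"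
    by (intro nn_integral_cong, subst ennreal_mult[symmetric]) (simp_all add: normal_density_def algebra_simps)
  also have "\<dots> = ennreal (normal_density 0 (sqrt (\<sigma>\<^sup>2 + \<tau>\<^sup>2)) (w - (\<mu> + \<nu>)))"
    using conv_normal_density_zero_mean[OF assms] by (rule fun_cong)
  finally show ?thesis by (simp add: normal_density_def)
qed

text \<open>The sum of independent normal variables is normal; the induction integrates out one
  coordinate at a time by convolution. This is what reduces the integral over all vertices to one
  over a single real variable.\<close>

lemma nn_integral_PiM_normal_sum:
  fixes f :: "real \<Rightarrow> ennreal" and \<mu> :: "nat \<Rightarrow> real"
  assumes "finite I" "I \<noteq> {}" and \<sigma>: "0 < \<sigma>" and [measurable]: "f \<in> borel_measurable borel"
  shows "(\<integral>\<^sup>+a. f (\<Sum>i\<in>I. a i) * (\<Prod>i\<in>I. ennreal (normal_density (\<mu> i) \<sigma> (a i))) \<partial>PiM I (\<lambda>_. lborel))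
    = (\<integral>\<^sup>+z. f z * ennreal (normal_density (\<Sum>i\<in>I. \<mu> i) (\<sigma> * sqrt (card I)) z) \<partial>lborel)"
  using assms(1,2,4)
proof (induction I arbitrary: f rule: finite_ne_induct)
  interpret product_sigma_finite "\<lambda>_::nat. lborel :: real measure" by standard
  case (singleton i)
  then show ?case
    by (simp add: product_nn_integral_singleton[of "\<lambda>x. f x * ennreal (normal_density (\<mu> i) \<sigma> x)" i])
next
  interpret product_sigma_finite "\<lambda>_::nat. lborel :: real measure" by standard
  case (insert i I)
  note [measurable] = insert.prems
  define h where "h s = (\<integral>\<^sup>+y. f (y + s) * ennreal (normal_density (\<mu> i) \<sigma> y) \<partial>lborel)" for s
  have [measurable]: "h \<in> borel_measurable borel" unfolding h_def by measurable
  let ?\<sigma> = "\<sigma> * sqrt (card I)" and ?m = "\<Sum>i\<in>I. \<mu> i"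
  have I: "0 < card I" using insert.hyps by (simp add: card_gt_0_iff)
  have "(\<integral>\<^sup>+a. f (\<Sum>j\<in>insert i I. a j) * (\<Prod>j\<in>insert i I. ennreal (normal_density (\<mu> j) \<sigma> (a j)))
        \<partial>PiM (insert i I) (\<lambda>_. lborel))
      = (\<integral>\<^sup>+x. (\<integral>\<^sup>+y. f (\<Sum>j\<in>insert i I. (x(i := y)) j)
          * (\<Prod>j\<in>insert i I. ennreal (normal_density (\<mu> j) \<sigma> ((x(i := y)) j))) \<partial>lborel) \<partial>PiM I (\<lambda>_. lborel))"
    using insert.hyps by (intro product_nn_integral_insert) auto
  also have "\<dots> = (\<integral>\<^sup>+x. h (\<Sum>j\<in>I. x j) * (\<Prod>j\<in>I. ennreal (normal_density (\<mu> j) \<sigma> (x j))) \<partial>PiM I (\<lambda>_. lborel))"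
  proof (rule nn_integral_cong)
    fix x :: "nat \<Rightarrow> real"
    have "(\<Sum>j\<in>insert i I. (x(i := y)) j) = y + (\<Sum>j\<in>I. x j)"
      "(\<Prod>j\<in>insert i I. ennreal (normal_density (\<mu> j) \<sigma> ((x(i := y)) j)))
        = ennreal (normal_density (\<mu> i) \<sigma> y) * (\<Prod>j\<in>I. ennreal (normal_density (\<mu> j) \<sigma> (x j)))" for y
    proof -
      have "(x(i := y)) j = x j" if "j \<in> I" for j using that insert.hyps by auto
      then show "(\<Sum>j\<in>insert i I. (x(i := y)) j) = y + (\<Sum>j\<in>I. x j)"
        "(\<Prod>j\<in>insert i I. ennreal (normal_density (\<mu> j) \<sigma> ((x(i := y)) j)))
          = ennreal (normal_density (\<mu> i) \<sigma> y) * (\<Prod>j\<in>I. ennreal (normal_density (\<mu> j) \<sigma> (x j)))"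
        using insert.hyps by (simp_all del: fun_upd_apply add: fun_upd_same)
    qed
    then show "(\<integral>\<^sup>+y. f (\<Sum>j\<in>insert i I. (x(i := y)) j)
          * (\<Prod>j\<in>insert i I. ennreal (normal_density (\<mu> j) \<sigma> ((x(i := y)) j))) \<partial>lborel)
        = h (\<Sum>j\<in>I. x j) * (\<Prod>j\<in>I. ennreal (normal_density (\<mu> j) \<sigma> (x j)))"
      unfolding h_def by (subst nn_integral_multc[symmetric]) (auto simp: mult.assoc)
  qed
  also have "\<dots> = (\<integral>\<^sup>+z. h z * ennreal (normal_density ?m ?\<sigma> z) \<partial>lborel)"
    by (rule insert.IH) measurable
  also have "\<dots> = (\<integral>\<^sup>+z. (\<integral>\<^sup>+w. f w * ennreal (normal_density (\<mu> i) \<sigma> (w - z))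
      * ennreal (normal_density ?m ?\<sigma> z) \<partial>lborel) \<partial>lborel)"
  proof (rule nn_integral_cong)
    fix z :: real
    have "h z = (\<integral>\<^sup>+w. f ((- z + 1 * w) + z) * ennreal (normal_density (\<mu> i) \<sigma> (- z + 1 * w)) \<partial>lborel)"
      unfolding h_def by (subst nn_integral_real_affine[where c = 1 and t = "- z"]) auto
    then show "h z * ennreal (normal_density ?m ?\<sigma> z) = (\<integral>\<^sup>+w. f w * ennreal (normal_density (\<mu> i) \<sigma> (w - z))
      * ennreal (normal_density ?m ?\<sigma> z) \<partial>lborel)"
      by (simp add: nn_integral_multc)
  qed
  also have "\<dots> = (\<integral>\<^sup>+w. (\<integral>\<^sup>+z. f w * ennreal (normal_density (\<mu> i) \<sigma> (w - z))
      * ennreal (normal_density ?m ?\<sigma> z) \<partial>lborel) \<partial>lborel)"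
    by (rule lborel_pair.Fubini') measurable
  also have "\<dots> = (\<integral>\<^sup>+w. f w * ennreal (normal_density (\<mu> i + ?m) (sqrt (\<sigma>\<^sup>2 + ?\<sigma>\<^sup>2)) w) \<partial>lborel)"
    using \<sigma> I
    by (intro nn_integral_cong) (simp add: mult.assoc nn_integral_cmult conv_normal_density)
  also have "sqrt (\<sigma>\<^sup>2 + ?\<sigma>\<^sup>2) = \<sigma> * sqrt (card (insert i I))"
  proof -
    have "\<sigma>\<^sup>2 + ?\<sigma>\<^sup>2 = \<sigma>\<^sup>2 * card (insert i I)"
      using insert.hyps by (simp add: power_mult_distrib algebra_simps)
    then show ?thesis using \<sigma> by (simp add: real_sqrt_mult)
  qed
  finally show ?case using insert.hyps by simp
qed

text \<open>Completing the square makes the coordinates independent with means l_i / n and variance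
  1 / n. Their sum has variance exactly 1, which is what a factor exp (z^2 / 2) inside
  \<open>f\<close> cancels.\<close>

lemma nn_integral_PiM_exp_sum:
  fixes f :: "real \<Rightarrow> ennreal" and l :: "nat \<Rightarrow> real"
  assumes n: "0 < n" and [measurable]: "f \<in> borel_measurable borel"
  shows "(\<integral>\<^sup>+a. f (\<Sum>i<n. a i) * ennreal (exp (\<Sum>i<n. l i * a i - n / 2 * (a i)\<^sup>2)) \<partial>PiM {..<n} (\<lambda>_. lborel))
    = ennreal (exp ((\<Sum>i<n. (l i)\<^sup>2) / (2 * real n)) * sqrt (2 * pi / n) ^ n)
        * (\<integral>\<^sup>+z. f z * ennreal (normal_density ((\<Sum>i<n. l i) / n) 1 z) \<partial>lborel)"
proof -
  have one: "exp (l * a - n / 2 * a\<^sup>2)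
      = exp (l\<^sup>2 / (2 * real n)) * sqrt (2 * pi / n) * normal_density (l / n) (1 / sqrt n) a" for l a :: real
  proof -
    have "l * a - n / 2 * a\<^sup>2 = l\<^sup>2 / (2 * real n) - (a - l / n)\<^sup>2 / (2 * (1 / sqrt n)\<^sup>2)"
      using n by (simp add: power_divide power2_eq_square field_simps)
    then have "exp (l * a - n / 2 * a\<^sup>2) = exp (l\<^sup>2 / (2 * real n)) * exp (- ((a - l / n)\<^sup>2 / (2 * (1 / sqrt n)\<^sup>2)))"
      by (simp add: mult_exp_exp)
    then show ?thesis using n by (simp add: normal_density_def power_divide real_sqrt_divide)
  qed
  have "exp (\<Sum>i<n. l i * a i - n / 2 * (a i)\<^sup>2)
      = exp ((\<Sum>i<n. (l i)\<^sup>2) / (2 * real n)) * sqrt (2 * pi / n) ^ n * (\<Prod>i<n. normal_density (l i / n) (1 / sqrt n) (a i))"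
    for a :: "nat \<Rightarrow> real"
    by (simp only: exp_sum finite_lessThan one prod.distrib sum_divide_distrib prod_constant card_lessThan)
  then have e: "ennreal (exp (\<Sum>i<n. l i * a i - n / 2 * (a i)\<^sup>2))
      = ennreal (exp ((\<Sum>i<n. (l i)\<^sup>2) / (2 * real n)) * sqrt (2 * pi / n) ^ n)
        * (\<Prod>i<n. ennreal (normal_density (l i / n) (1 / sqrt n) (a i)))"
    for a :: "nat \<Rightarrow> real"
    by (simp add: ennreal_mult[symmetric] prod_ennreal prod_nonneg)
  have "(\<integral>\<^sup>+a. f (\<Sum>i<n. a i) * ennreal (exp (\<Sum>i<n. l i * a i - n / 2 * (a i)\<^sup>2)) \<partial>PiM {..<n} (\<lambda>_. lborel))
     = ennreal (exp ((\<Sum>i<n. (l i)\<^sup>2) / (2 * real n)) * sqrt (2 * pi / n) ^ n)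
        * (\<integral>\<^sup>+a. f (\<Sum>i<n. a i) * (\<Prod>i<n. ennreal (normal_density (l i / n) (1 / sqrt n) (a i))) \<partial>PiM {..<n} (\<lambda>_. lborel))"
    unfolding e by (subst nn_integral_cmult[symmetric]) (measurable, simp add: mult.left_commute)
  also have "(\<integral>\<^sup>+a. f (\<Sum>i<n. a i) * (\<Prod>i<n. ennreal (normal_density (l i / n) (1 / sqrt n) (a i))) \<partial>PiM {..<n} (\<lambda>_. lborel))
     = (\<integral>\<^sup>+z. f z * ennreal (normal_density (\<Sum>i<n. l i / n) (1 / sqrt n * sqrt (card {..<n})) z) \<partial>lborel)"
    using n by (intro nn_integral_PiM_normal_sum) (auto simp: lessThan_empty_iff)
  finally show ?thesis using n by (simp add: sum_divide_distrib)
qed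

section \<open>The partition function at criticality\<close>

text \<open>All factors of the two bounds that come from normalizations: the Hubbard-Stratonovich
  constants, the number of sign graphs and the Gaussian integrals. It cancels in every
  ratio.\<close>

definition ergm_scale :: "nat \<Rightarrow> real" where
  "ergm_scale n = exp (- real n / 4) * sqrt ((real n - 1) / pi) ^ n * 2 ^ card (edges n)
     * sqrt (2 * pi / n) ^ n / sqrt (2 * pi)"

lemma ergm_scale_pos: "2 \<le> n \<Longrightarrow> 0 < ergm_scale n"
  unfolding ergm_scale_def by (intro divide_pos_pos mult_pos_pos zero_less_power) auto

text \<open>Completing the square. On the right \<open>k\<close> occurs only linearly in the
  exponent, so the sum over the graphs can be carried out under the integral; the centre \<beta> / 2
  accounts for the linear term.\<close>

lemma hubbard_stratonovich:
  assumes c: "0 < c"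
  shows "ennreal (exp (k\<^sup>2 / (4 * c) + \<beta> * k / 2))
    = ennreal (sqrt (c / pi)) * (\<integral>\<^sup>+a. ennreal (exp (- c * (a - \<beta> / 2)\<^sup>2 + a * k)) \<partial>lborel)"
proof -
  define \<sigma> where "\<sigma> = 1 / sqrt (2 * c)"
  have \<sigma>: "0 < \<sigma>" "\<sigma>\<^sup>2 = 1 / (2 * c)" using c by (simp_all add: \<sigma>_def power_divide)
  have e: "sqrt (c / pi) * exp (- c * (a - \<beta> / 2)\<^sup>2 + a * k)
      = exp (k\<^sup>2 / (4 * c) + \<beta> * k / 2) * normal_density (\<beta> / 2 + k / (2 * c)) \<sigma> a" for a
  proof -
    have "- c * (a - \<beta> / 2)\<^sup>2 + a * k
        = (k\<^sup>2 / (4 * c) + \<beta> * k / 2) + - (a - (\<beta> / 2 + k / (2 * c)))\<^sup>2 / (2 * \<sigma>\<^sup>2)"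
      unfolding \<sigma>(2) using c by (simp add: power2_eq_square field_simps)
    then have "exp (- c * (a - \<beta> / 2)\<^sup>2 + a * k)
        = exp (k\<^sup>2 / (4 * c) + \<beta> * k / 2) * exp (- (a - (\<beta> / 2 + k / (2 * c)))\<^sup>2 / (2 * \<sigma>\<^sup>2))"
      by (simp only: mult_exp_exp)
    moreover have "sqrt (c / pi) = 1 / sqrt (2 * pi * \<sigma>\<^sup>2)"
      by (simp add: \<sigma>(2) real_sqrt_divide)
    ultimately show ?thesis unfolding normal_density_def by simp
  qed
  have "ennreal (sqrt (c / pi)) * (\<integral>\<^sup>+a. ennreal (exp (- c * (a - \<beta> / 2)\<^sup>2 + a * k)) \<partial>lborel)
      = (\<integral>\<^sup>+a. ennreal (sqrt (c / pi) * exp (- c * (a - \<beta> / 2)\<^sup>2 + a * k)) \<partial>lborel)"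
    using c by (subst nn_integral_cmult[symmetric]) (auto simp: ennreal_mult)
  also have "\<dots> = (\<integral>\<^sup>+a. ennreal (exp (k\<^sup>2 / (4 * c) + \<beta> * k / 2)) * ennreal (normal_density (\<beta> / 2 + k / (2 * c)) \<sigma> a) \<partial>lborel)"
    unfolding e by (simp add: ennreal_mult)
  also have "\<dots> = ennreal (exp (k\<^sup>2 / (4 * c) + \<beta> * k / 2))"
    using prob_space_normal_density[OF \<sigma>(1), THEN prob_space.emeasure_space_1]
    by (simp add: nn_integral_cmult emeasure_density)
  finally show ?thesis by simp
qed

lemma ergm_weight_half:
  assumes "2 \<le> n"
  shows "ergm_weight n (1 / 2) (vec n b) Y = exp (- real n / 4)
    * (\<Prod>i<n. exp ((node_degree Y i)\<^sup>2 / (4 * (real n - 1)) + b i * node_degree Y i / 2))"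
proof -
  have "1 / 2 / (real n - 1) * (1 / 2 * (\<Sum>i<n. (node_degree Y i)\<^sup>2) - real n * (real n - 1) / 2)
      = - real n / 4 + (\<Sum>i<n. (node_degree Y i)\<^sup>2) / (4 * (real n - 1))"
    using assms by (simp add: field_simps)
  then show ?thesis
    by (simp add: ergm_weight_def exp_sum[symmetric] mult_exp_exp sum.distrib sum_divide_distrib)
qed

lemma cosh_eq_exp_gap: "cosh x = exp (x\<^sup>2 / 2) * exp (- cosh_gap x)" for x :: real
  by (simp add: cosh_gap_def mult_exp_exp cosh_real_pos)

lemma prod_cosh_eq:
  fixes a :: "nat \<Rightarrow> real"
  shows "(\<Prod>(i, j)\<in>edges n. cosh (a i + a j))
    = exp ((real n - 2) / 2 * (\<Sum>i<n. (a i)\<^sup>2) + (\<Sum>i<n. a i)\<^sup>2 / 2 - (\<Sum>(i, j)\<in>edges n. cosh_gap (a i + a j)))"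
proof -
  have "(\<Prod>(i, j)\<in>edges n. cosh (a i + a j))
      = exp ((\<Sum>(i, j)\<in>edges n. (a i + a j)\<^sup>2) / 2 - (\<Sum>(i, j)\<in>edges n. cosh_gap (a i + a j)))"
    unfolding cosh_eq_exp_gap mult_exp_exp case_prod_unfold exp_sum[OF finite_edges, symmetric]
    by (simp add: sum_subtractf sum_divide_distrib)
  then show ?thesis by (simp add: sum_edges_power2 add_divide_distrib)
qed

text \<open>An unnormalized product Gaussian, with mean l_i / n and variance 1 / n in each
  coordinate.\<close>

definition tilt_weight :: "nat \<Rightarrow> (nat \<Rightarrow> real) \<Rightarrow> (nat \<Rightarrow> real) \<Rightarrow> real" where
  "tilt_weight n l a = exp (\<Sum>i<n. l i * a i - n / 2 * (a i)\<^sup>2)"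

definition edge_gap :: "nat \<Rightarrow> (nat \<Rightarrow> real) \<Rightarrow> real" where
  "edge_gap n a = (\<Sum>(i, j)\<in>edges n. cosh_gap (a i + a j))"

lemma measurable_cosh_gap [measurable]: "cosh_gap \<in> borel_measurable borel"
proof -
  have "continuous_on UNIV cosh_gap"
    by (rule DERIV_continuous_on) (rule DERIV_cosh_gap[THEN DERIV_subset], simp)
  then show ?thesis by (rule borel_measurable_continuous_onI)
qed

lemma measurable_tilt_weight [measurable]:
  "tilt_weight n l \<in> borel_measurable (PiM {..<n} (\<lambda>_. lborel))"
  unfolding tilt_weight_def [abs_def] by measurable

lemma measurable_edge_gap [measurable]:
  "edge_gap n \<in> borel_measurable (PiM {..<n} (\<lambda>_. lborel))"
proof -
  have "(\<lambda>a. cosh_gap (a (fst e) + a (snd e))) \<in> borel_measurable (PiM {..<n} (\<lambda>_. lborel))"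
    if "e \<in> edges n" for e
  proof -
    have [measurable]: "fst e \<in> {..<n}" "snd e \<in> {..<n}" using that by (auto simp: edges_def)
    show ?thesis by measurable
  qed
  then show ?thesis
    unfolding edge_gap_def [abs_def] case_prod_unfold by (rule borel_measurable_sum)
qed

lemma edge_gap_nonneg: "0 \<le> edge_gap n a"
  unfolding edge_gap_def by (intro sum_nonneg) (auto simp: cosh_gap_nonneg)

lemma ergm_Z_eq_nn_integral:
  assumes n: "2 \<le> n"
  shows "ennreal (ergm_Z n (1 / 2) (vec n b))
    = ennreal (exp (- real n / 4) * sqrt ((real n - 1) / pi) ^ n * 2 ^ card (edges n)
          * exp (- (real n - 1) / 4 * (\<Sum>i<n. (b i)\<^sup>2)))
      * (\<integral>\<^sup>+a. ennreal (exp ((\<Sum>i<n. a i)\<^sup>2 / 2 - edge_gap n a))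
          * ennreal (tilt_weight n (\<lambda>i. (real n - 1) * b i) a) \<partial>PiM {..<n} (\<lambda>_. lborel))"
proof -
  interpret product_sigma_finite "\<lambda>_::nat. lborel :: real measure" by standard
  let ?M = "PiM {..<n} (\<lambda>_. lborel :: real measure)"
  define c where "c = real n - 1"
  have c: "0 < c" using n by (simp add: c_def)
  define q where "q a = (\<Sum>i<n. - c * (a i - b i / 2)\<^sup>2)" for a :: "nat \<Rightarrow> real"
  have one: "ennreal (ergm_weight n (1 / 2) (vec n b) Y)
      = ennreal (exp (- real n / 4) * sqrt (c / pi) ^ n)
        * (\<integral>\<^sup>+a. ennreal (exp (q a) * exp (\<Sum>i<n. a i * node_degree Y i)) \<partial>?M)" for Y
  proof -
    have "ennreal (ergm_weight n (1 / 2) (vec n b) Y) = ennreal (exp (- real n / 4))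
      * (\<Prod>i<n. ennreal (exp ((node_degree Y i)\<^sup>2 / (4 * c) + b i * node_degree Y i / 2)))"
      unfolding ergm_weight_half[OF n] c_def by (simp add: ennreal_mult prod_ennreal prod_nonneg)
    also have "\<dots> = ennreal (exp (- real n / 4)) * (\<Prod>i<n. ennreal (sqrt (c / pi))
        * (\<integral>\<^sup>+a. ennreal (exp (- c * (a - b i / 2)\<^sup>2 + a * node_degree Y i)) \<partial>lborel))"
      by (simp only: hubbard_stratonovich[OF c])
    also have "\<dots> = ennreal (exp (- real n / 4) * sqrt (c / pi) ^ n)
        * (\<Prod>i<n. \<integral>\<^sup>+a. ennreal (exp (- c * (a - b i / 2)\<^sup>2 + a * node_degree Y i)) \<partial>lborel)"
      using c by (simp add: prod.distrib ennreal_mult ennreal_power mult.assoc)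
    also have "(\<Prod>i<n. \<integral>\<^sup>+a. ennreal (exp (- c * (a - b i / 2)\<^sup>2 + a * node_degree Y i)) \<partial>lborel)
        = (\<integral>\<^sup>+a. (\<Prod>i<n. ennreal (exp (- c * (a i - b i / 2)\<^sup>2 + a i * node_degree Y i))) \<partial>?M)"
      by (rule product_nn_integral_prod[symmetric]) auto
    also have "\<dots> = (\<integral>\<^sup>+a. ennreal (exp (q a) * exp (\<Sum>i<n. a i * node_degree Y i)) \<partial>?M)"
      by (intro nn_integral_cong)
        (simp add: prod_ennreal exp_sum[symmetric] sum.distrib[symmetric] q_def mult_exp_exp)
    finally show ?thesis .
  qed
  have [measurable]: "q \<in> borel_measurable ?M" unfolding q_def [abs_def] by measurable
  have pointwise: "(\<Sum>Y\<in>sign_graphs n. exp (q a) * exp (\<Sum>i<n. a i * node_degree Y i))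
      = 2 ^ card (edges n) * exp (- c / 4 * (\<Sum>i<n. (b i)\<^sup>2))
        * (exp ((\<Sum>i<n. a i)\<^sup>2 / 2 - edge_gap n a) * tilt_weight n (\<lambda>i. c * b i) a)" for a
  proof -
    \<comment> \<open>The coefficient of each square is -(n - 1) + (n - 2) / 2 = - n / 2: this is
      where the variance 1 / n, and hence criticality of the sum, comes from.\<close>
    have q: "q a + (real n - 2) / 2 * (\<Sum>i<n. (a i)\<^sup>2) = - c / 4 * (\<Sum>i<n. (b i)\<^sup>2) + (\<Sum>i<n. c * b i * a i - n / 2 * (a i)\<^sup>2)"
      unfolding q_def sum_distrib_left sum.distrib[symmetric]
      by (intro sum.cong) (auto simp: c_def power2_eq_square field_simps)
    have "(\<Sum>Y\<in>sign_graphs n. exp (q a) * exp (\<Sum>i<n. a i * node_degree Y i))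
        = 2 ^ card (edges n) * (exp (q a) * (\<Prod>(i, j)\<in>edges n. cosh (a i + a j)))"
      unfolding sum_distrib_left[symmetric] sum_exp_node_degree
      by (simp add: case_prod_unfold prod.distrib)
    also have "exp (q a) * (\<Prod>(i, j)\<in>edges n. cosh (a i + a j))
        = exp (q a + (real n - 2) / 2 * (\<Sum>i<n. (a i)\<^sup>2)) * exp ((\<Sum>i<n. a i)\<^sup>2 / 2 - edge_gap n a)"
      unfolding prod_cosh_eq edge_gap_def mult_exp_exp by (simp add: algebra_simps)
    also have "\<dots> = exp (- c / 4 * (\<Sum>i<n. (b i)\<^sup>2)) * (exp ((\<Sum>i<n. a i)\<^sup>2 / 2 - edge_gap n a) * tilt_weight n (\<lambda>i. c * b i) a)"
      unfolding q exp_add tilt_weight_def by (simp only: mult_ac)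
    finally show ?thesis by (simp only: mult.assoc)
  qed
  have "ennreal (ergm_Z n (1 / 2) (vec n b)) = (\<Sum>Y\<in>sign_graphs n. ennreal (ergm_weight n (1 / 2) (vec n b) Y))"
    unfolding ergm_Z_def by (rule sum_ennreal[symmetric]) (simp add: less_imp_le)
  also have "\<dots> = ennreal (exp (- real n / 4) * sqrt (c / pi) ^ n)
      * (\<Sum>Y\<in>sign_graphs n. \<integral>\<^sup>+a. ennreal (exp (q a) * exp (\<Sum>i<n. a i * node_degree Y i)) \<partial>?M)"
    unfolding one sum_distrib_left ..
  also have "(\<Sum>Y\<in>sign_graphs n. \<integral>\<^sup>+a. ennreal (exp (q a) * exp (\<Sum>i<n. a i * node_degree Y i)) \<partial>?M)
      = (\<integral>\<^sup>+a. (\<Sum>Y\<in>sign_graphs n. ennreal (exp (q a) * exp (\<Sum>i<n. a i * node_degree Y i))) \<partial>?M)"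
    by (rule nn_integral_sum[symmetric]) measurable
  also have "\<dots> = (\<integral>\<^sup>+a. ennreal (2 ^ card (edges n) * exp (- c / 4 * (\<Sum>i<n. (b i)\<^sup>2)))
        * (ennreal (exp ((\<Sum>i<n. a i)\<^sup>2 / 2 - edge_gap n a)) * ennreal (tilt_weight n (\<lambda>i. c * b i) a)) \<partial>?M)"
    by (intro nn_integral_cong, subst sum_ennreal, simp, subst pointwise) (simp add: ennreal_mult tilt_weight_def)
  also have "\<dots> = ennreal (2 ^ card (edges n) * exp (- c / 4 * (\<Sum>i<n. (b i)\<^sup>2)))
        * (\<integral>\<^sup>+a. ennreal (exp ((\<Sum>i<n. a i)\<^sup>2 / 2 - edge_gap n a)) * ennreal (tilt_weight n (\<lambda>i. c * b i) a) \<partial>?M)"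
    by (rule nn_integral_cmult) measurable
  finally show ?thesis
    unfolding c_def[symmetric] using c by (simp add: ennreal_mult mult.assoc)
qed

section \<open>Upper bound for the partition function\<close>

lemma nn_integral_tilt_weight:
  fixes f :: "real \<Rightarrow> ennreal"
  assumes "0 < n" "f \<in> borel_measurable borel"
  shows "(\<integral>\<^sup>+a. f (\<Sum>i<n. a i) * ennreal (tilt_weight n l a) \<partial>PiM {..<n} (\<lambda>_. lborel))
    = ennreal (exp ((\<Sum>i<n. (l i)\<^sup>2) / (2 * real n)) * sqrt (2 * pi / n) ^ n)
        * (\<integral>\<^sup>+z. f z * ennreal (normal_density ((\<Sum>i<n. l i) / n) 1 z) \<partial>lborel)"
  unfolding tilt_weight_def by (rule nn_integral_PiM_exp_sum[OF assms])

lemma nn_integral_exp_minus_abs: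
  assumes c: "0 < c"
  shows "(\<integral>\<^sup>+z. ennreal (exp (- \<bar>z\<bar> / c)) \<partial>lborel) \<le> ennreal (2 * c)"
proof -
  have half: "(\<integral>\<^sup>+z. ennreal (exp (- z / c)) * indicator {0..} z \<partial>lborel) = ennreal c"
  proof -
    have "(\<integral>\<^sup>+z. ennreal (exp (- z / c)) * indicator {0..} z \<partial>lborel) = ennreal (0 - (- c * exp (- 0 / c)))"
    proof (rule nn_integral_FTC_atLeast)
      fix x :: real
      show "((\<lambda>z. - c * exp (- z / c)) has_real_derivative exp (- x / c)) (at x)"
        using c by (auto intro!: derivative_eq_intros)
      show "((\<lambda>z. - c * exp (- z / c)) \<longlongrightarrow> 0) at_top"
        using c by real_asymp
    qed auto
    then show ?thesis by simp
  qed
  have "(\<integral>\<^sup>+z. ennreal (exp (- \<bar>z\<bar> / c)) \<partial>lborel)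
      \<le> (\<integral>\<^sup>+z. ennreal (exp (- z / c)) * indicator {0..} z
          + ennreal (exp (- (- z) / c)) * indicator {0..} (- z) \<partial>lborel)"
    by (intro nn_integral_mono) (auto simp: indicator_def)
  also have "\<dots> = (\<integral>\<^sup>+z. ennreal (exp (- z / c)) * indicator {0..} z \<partial>lborel)
      + (\<integral>\<^sup>+z. ennreal (exp (- (- z) / c)) * indicator {0..} (- z) \<partial>lborel)"
    by (rule nn_integral_add) measurable
  also have "(\<integral>\<^sup>+z. ennreal (exp (- (- z) / c)) * indicator {0..} (- z) \<partial>lborel)
      = (\<integral>\<^sup>+z. ennreal (exp (- z / c)) * indicator {0..} z \<partial>lborel)"
    by (subst nn_integral_real_affine[where c = "- 1" and t = 0]) auto
  finally show ?thesis unfolding half using c by (simp add: ennreal_plus[symmetric] del: ennreal_plus)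
qed

text \<open>Jensen's inequality: 2 * (sum of a) / n is the mean of a_i + a_j over the edges, so the
  linear parts of the tangents at this point sum to zero.\<close>

lemma edge_gap_ge:
  assumes "2 \<le> n"
  shows "real n * (real n - 1) / 2 * cosh_gap (2 * (\<Sum>i<n. a i) / n) \<le> edge_gap n a"
proof -
  define m where "m = 2 * (\<Sum>i<n. a i) / n"
  have "(\<Sum>(i, j)\<in>edges n. cosh_gap m + (m - tanh m) * ((a i + a j) - m))
      = real (card (edges n)) * cosh_gap m
        + (m - tanh m) * ((\<Sum>(i, j)\<in>edges n. a i + a j) - real (card (edges n)) * m)"
    by (simp add: case_prod_unfold sum.distrib sum_distrib_left[symmetric] sum_subtractf)
  also have "(\<Sum>(i, j)\<in>edges n. a i + a j) = real (card (edges n)) * m"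
    using assms by (simp add: sum_edges_add card_edges m_def)
  finally have "real (card (edges n)) * cosh_gap m
      = (\<Sum>(i, j)\<in>edges n. cosh_gap m + (m - tanh m) * ((a i + a j) - m))" by simp
  also have "\<dots> \<le> edge_gap n a"
    unfolding edge_gap_def by (intro sum_mono) (auto simp: cosh_gap_above_tangent)
  finally show ?thesis by (simp add: card_edges m_def)
qed

text \<open>The tangent point 4 / sqrt n gives slope 8/3 in units of |z| / sqrt n, rounded down to 2
  so that a tilt of slope 1 can still be absorbed. The bound n \<ge> 64 keeps the tangent point
  below 1/2.\<close>

lemma edge_count_cosh_gap_ge:
  assumes n: "64 \<le> n"
  shows "2 * \<bar>z\<bar> / sqrt n - 16 / 3 \<le> real n * (real n - 1) / 2 * cosh_gap (2 * z / n)"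
proof -
  define r where "r = sqrt n"
  have r: "8 \<le> r" and nr: "real n = r\<^sup>2"
    using n real_le_rsqrt[of 8 n] by (simp_all add: r_def)
  define y where "y = 4 / r"
  have y: "0 \<le> y" "y \<le> 1 / 2" using r by (simp_all add: y_def field_simps)
  have "2 * \<bar>z\<bar> / r - 16 / 3 \<le> 8 / 3 * (\<bar>z\<bar> / r) - 16 / 3"
  proof -
    have "0 \<le> \<bar>z\<bar> / r" using r by simp
    then show ?thesis by simp
  qed
  also have "\<dots> = r ^ 4 / 4 * (y ^ 3 / 12 * (\<bar>2 * z / n\<bar> - y))"
  proof -
    have z: "\<bar>2 * z / n\<bar> = 2 * \<bar>z\<bar> / r\<^sup>2" by (simp add: nr abs_mult)
    show ?thesis unfolding z y_def using r by (simp add: field_simps power_divide eval_nat_numeral)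
  qed
  also have "\<dots> \<le> r ^ 4 / 4 * cosh_gap (2 * z / n)"
    by (intro mult_left_mono cosh_gap_ge_linear y) simp
  also have "\<dots> \<le> real n * (real n - 1) / 2 * cosh_gap (2 * z / n)"
  proof (rule mult_right_mono[OF _ cosh_gap_nonneg])
    have "real n * real n / 4 \<le> real n * (real n - 1) / 2"
      using n by (simp add: field_simps)
    then show "r ^ 4 / 4 \<le> real n * (real n - 1) / 2"
      unfolding nr by (simp add: eval_nat_numeral mult.assoc)
  qed
  finally show ?thesis by (simp add: r_def)
qed

text \<open>By convexity of \<^const>\<open>cosh_gap\<close> the integrand is dominated by a Gaussian times a function
  of the sum, and the quadratic part of the latter cancels at criticality; its quartic part
  confines the sum to the scale \<open>sqrt n\<close>.\<close>

lemma ergm_Z_le: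
  assumes n: "64 \<le> n" and b: "\<bar>\<Sum>i<n. b i\<bar> * sqrt n \<le> 1"
  shows "ergm_Z n (1 / 2) (vec n b)
    \<le> ergm_scale n * sqrt n * (2 * exp (16 / 3)) * exp (n / 4 * (\<Sum>i<n. (b i)\<^sup>2))"
proof -
  let ?M = "PiM {..<n} (\<lambda>_. lborel :: real measure)"
  define N where "N = real n * (real n - 1) / 2"
  define c where "c = real n - 1"
  define l where "l i = c * b i" for i
  define B where "B = (\<Sum>i<n. (b i)\<^sup>2)"
  define \<Lambda> where "\<Lambda> = (\<Sum>i<n. l i) / n"
  define f where "f z = exp (z\<^sup>2 / 2 - N * cosh_gap (2 * z / n))" for z
  define K where "K = exp (- real n / 4) * sqrt ((real n - 1) / pi) ^ n * 2 ^ card (edges n)"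
  have K: "0 \<le> K" using n by (simp add: K_def)
  \<comment> \<open>The tilt moves the mean of the sum to \<Lambda>, which is harmless as long as
    \<Lambda> * z stays bounded on the scale |z| of order sqrt n.\<close>
  have \<Lambda>: "\<bar>\<Lambda>\<bar> * sqrt n \<le> 1"
  proof -
    have "\<bar>\<Lambda>\<bar> = c / n * \<bar>\<Sum>i<n. b i\<bar>"
      using n by (simp add: \<Lambda>_def l_def c_def sum_distrib_left[symmetric] abs_mult)
    also have "\<dots> \<le> 1 * \<bar>\<Sum>i<n. b i\<bar>" using n by (intro mult_right_mono) (auto simp: c_def)
    finally have "\<bar>\<Lambda>\<bar> * sqrt n \<le> \<bar>\<Sum>i<n. b i\<bar> * sqrt n" by (intro mult_right_mono) auto
    then show ?thesis using b by simp
  qed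
  have [measurable]: "(\<lambda>z. ennreal (f z)) \<in> borel_measurable borel" unfolding f_def by measurable
  have int: "(\<integral>\<^sup>+z. ennreal (f z) * ennreal (normal_density \<Lambda> 1 z) \<partial>lborel)
      \<le> ennreal (exp (16 / 3) * (2 * sqrt n) / sqrt (2 * pi))"
  proof -
    have "f z * normal_density \<Lambda> 1 z \<le> exp (16 / 3) / sqrt (2 * pi) * exp (- \<bar>z\<bar> / sqrt n)" for z
    proof -
      have "\<Lambda> * z \<le> \<bar>\<Lambda>\<bar> * \<bar>z\<bar>" by (metis abs_ge_self abs_mult)
      also have "\<dots> = \<bar>\<Lambda>\<bar> * sqrt n * (\<bar>z\<bar> / sqrt n)" using n by simp
      also have "\<dots> \<le> 1 * (\<bar>z\<bar> / sqrt n)" using \<Lambda> by (intro mult_right_mono) auto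
      finally have "\<Lambda> * z \<le> \<bar>z\<bar> / sqrt n" by simp
      moreover have "z\<^sup>2 / 2 - (z - \<Lambda>)\<^sup>2 / 2 \<le> \<Lambda> * z" by (simp add: power2_diff field_simps)
      \<comment> \<open>Half of the decay 2 * |z| / sqrt n pays for the tilt; the other half makes
        the integral of order sqrt n.\<close>
      ultimately have "z\<^sup>2 / 2 - N * cosh_gap (2 * z / n) - (z - \<Lambda>)\<^sup>2 / 2 \<le> 16 / 3 - \<bar>z\<bar> / sqrt n"
        using edge_count_cosh_gap_ge[OF n, of z] unfolding N_def by simp
      then have "exp (z\<^sup>2 / 2 - N * cosh_gap (2 * z / n) - (z - \<Lambda>)\<^sup>2 / 2) \<le> exp (16 / 3 - \<bar>z\<bar> / sqrt n)"
        by (simp only: exp_le_cancel_iff)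
      then have "exp (z\<^sup>2 / 2 - N * cosh_gap (2 * z / n)) * exp (- (z - \<Lambda>)\<^sup>2 / 2) \<le> exp (16 / 3) * exp (- \<bar>z\<bar> / sqrt n)"
        by (simp add: mult_exp_exp)
      from divide_right_mono[OF this, of "sqrt (2 * pi)"]
      show ?thesis by (simp add: f_def normal_density_def)
    qed
    then have "(\<integral>\<^sup>+z. ennreal (f z) * ennreal (normal_density \<Lambda> 1 z) \<partial>lborel)
        \<le> (\<integral>\<^sup>+z. ennreal (exp (16 / 3) / sqrt (2 * pi)) * ennreal (exp (- \<bar>z\<bar> / sqrt n)) \<partial>lborel)"
      by (intro nn_integral_mono) (simp add: ennreal_mult[symmetric] f_def)
    also have "\<dots> = ennreal (exp (16 / 3) / sqrt (2 * pi)) * (\<integral>\<^sup>+z. ennreal (exp (- \<bar>z\<bar> / sqrt n)) \<partial>lborel)"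
      by (rule nn_integral_cmult) measurable
    also have "\<dots> \<le> ennreal (exp (16 / 3) / sqrt (2 * pi)) * ennreal (2 * sqrt n)"
      using n by (intro mult_left_mono nn_integral_exp_minus_abs) auto
    finally show ?thesis by (simp add: ennreal_mult[symmetric])
  qed
  have "ennreal (ergm_Z n (1 / 2) (vec n b)) = ennreal (K * exp (- c / 4 * B))
      * (\<integral>\<^sup>+a. ennreal (exp ((\<Sum>i<n. a i)\<^sup>2 / 2 - edge_gap n a)) * ennreal (tilt_weight n l a) \<partial>?M)"
    using ergm_Z_eq_nn_integral[of n b] n unfolding K_def B_def l_def [abs_def] c_def by simp
  also have "\<dots> \<le> ennreal (K * exp (- c / 4 * B))
      * (\<integral>\<^sup>+a. ennreal (f (\<Sum>i<n. a i)) * ennreal (tilt_weight n l a) \<partial>?M)"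
    using edge_gap_ge[of n] n
    by (intro mult_left_mono nn_integral_mono mult_right_mono) (auto simp: f_def N_def)
  also have "(\<integral>\<^sup>+a. ennreal (f (\<Sum>i<n. a i)) * ennreal (tilt_weight n l a) \<partial>?M)
      = ennreal (exp ((\<Sum>i<n. (l i)\<^sup>2) / (2 * real n)) * sqrt (2 * pi / n) ^ n)
        * (\<integral>\<^sup>+z. ennreal (f z) * ennreal (normal_density \<Lambda> 1 z) \<partial>lborel)"
    unfolding \<Lambda>_def using n by (intro nn_integral_tilt_weight) auto
  also have "\<dots> \<le> ennreal (exp ((\<Sum>i<n. (l i)\<^sup>2) / (2 * real n)) * sqrt (2 * pi / n) ^ n)
      * ennreal (exp (16 / 3) * (2 * sqrt n) / sqrt (2 * pi))"
    by (intro mult_left_mono int) auto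
  finally have "ennreal (ergm_Z n (1 / 2) (vec n b)) \<le> ennreal (K * exp (- c / 4 * B)
      * (exp ((\<Sum>i<n. (l i)\<^sup>2) / (2 * real n)) * sqrt (2 * pi / n) ^ n
         * (exp (16 / 3) * (2 * sqrt n) / sqrt (2 * pi))))"
    using K by (simp add: ennreal_mult[symmetric] mult_left_mono)
  then have "ergm_Z n (1 / 2) (vec n b) \<le> K * exp (- c / 4 * B)
      * (exp ((\<Sum>i<n. (l i)\<^sup>2) / (2 * real n)) * sqrt (2 * pi / n) ^ n
         * (exp (16 / 3) * (2 * sqrt n) / sqrt (2 * pi)))"
    using K by (subst (asm) ennreal_le_iff) auto
  also have "\<dots> = ergm_scale n * sqrt n * (2 * exp (16 / 3)) * exp (- c / 4 * B + (\<Sum>i<n. (l i)\<^sup>2) / (2 * real n))"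
    unfolding exp_add by (simp add: ergm_scale_def K_def)
  also have "\<dots> \<le> ergm_scale n * sqrt n * (2 * exp (16 / 3)) * exp (n / 4 * B)"
  proof (rule mult_left_mono)
    \<comment> \<open>The square from the tilted Gaussian contributes at most c / 2 and the
      prefactor - c / 4, which leaves c / 4 and hence at most n / 4.\<close>
    have "c\<^sup>2 / (2 * real n) \<le> c / 2"
      using n by (simp add: c_def power2_eq_square field_simps)
    then have "(\<Sum>i<n. (l i)\<^sup>2) / (2 * real n) \<le> c / 2 * B"
      using mult_right_mono[of "c\<^sup>2 / (2 * real n)" "c / 2" B]
      by (simp add: l_def B_def power_mult_distrib sum_distrib_left[symmetric] sum_nonneg)
    moreover have "c / 4 * B \<le> n / 4 * B" by (intro mult_right_mono) (auto simp: c_def B_def sum_nonneg)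
    ultimately show "exp (- c / 4 * B + (\<Sum>i<n. (l i)\<^sup>2) / (2 * real n)) \<le> exp (n / 4 * B)"
      by simp
  qed (use n ergm_scale_pos[of n] in \<open>simp add: less_imp_le\<close>)
  finally show ?thesis by (simp add: B_def)
qed

section \<open>Lower bound for the partition function\<close>

lemma edge_gap_le:
  fixes x :: real and a :: "nat \<Rightarrow> real"
  assumes n: "0 < n"
  shows "edge_gap n a \<le> 16 / 3 * x ^ 4
    + 4096 / (3 * real n) * (\<Sum>i<n. exp (sqrt n * a i - x) + exp (- (sqrt n * a i - x)))"
proof -
  define r where "r = sqrt n"
  have r: "0 < r" and nr: "real n = r\<^sup>2" using n by (simp_all add: r_def)
  \<comment> \<open>If the sum is near x * sqrt n, a coordinate is near x / sqrt n with fluctuations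
    of order 1 / sqrt n; hence the recentring. Exponentials replace the fourth power because their
    moments are mere changes of the tilt.\<close>
  have one: "(a i) ^ 4 \<le> 8 * (x ^ 4 + 256 * (exp (r * a i - x) + exp (- (r * a i - x)))) / (real n)\<^sup>2" for i
  proof -
    have "(r * a i) ^ 4 = (x + (r * a i - x)) ^ 4" by simp
    also have "\<dots> \<le> 8 * (x ^ 4 + (r * a i - x) ^ 4)" by (rule power4_add_le)
    also have "\<dots> \<le> 8 * (x ^ 4 + 256 * (exp (r * a i - x) + exp (- (r * a i - x))))"
      by (intro mult_left_mono add_left_mono power4_le_exp) simp
    finally have "(real n)\<^sup>2 * (a i) ^ 4 \<le> 8 * (x ^ 4 + 256 * (exp (r * a i - x) + exp (- (r * a i - x))))"
      by (simp add: nr power_mult_distrib power_mult[symmetric])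
    then show ?thesis using n by (simp add: field_simps)
  qed
  have "edge_gap n a \<le> (\<Sum>(i, j)\<in>edges n. 2 / 3 * ((a i) ^ 4 + (a j) ^ 4))"
    unfolding edge_gap_def
  proof (intro sum_mono, clarify)
    fix i j
    have "cosh_gap (a i + a j) \<le> (a i + a j) ^ 4 / 12" by (rule cosh_gap_le)
    also have "\<dots> \<le> 8 * ((a i) ^ 4 + (a j) ^ 4) / 12" by (intro divide_right_mono power4_add_le) simp
    finally show "cosh_gap (a i + a j) \<le> 2 / 3 * ((a i) ^ 4 + (a j) ^ 4)" by simp
  qed
  also have "\<dots> = 2 / 3 * ((real n - 1) * (\<Sum>i<n. (a i) ^ 4))"
    unfolding sum_edges_add[of "\<lambda>i. (a i) ^ 4" n, symmetric]
    by (simp only: case_prod_unfold sum_distrib_left)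
  also have "\<dots> \<le> 2 / 3 * (real n * (\<Sum>i<n. (a i) ^ 4))"
    by (intro mult_left_mono mult_right_mono) (auto simp: sum_nonneg)
  also have "\<dots> \<le> 2 / 3 * (real n * (\<Sum>i<n. 8 * (x ^ 4 + 256 * (exp (r * a i - x) + exp (- (r * a i - x)))) / (real n)\<^sup>2))"
    by (intro mult_left_mono sum_mono one) auto
  also have "(\<Sum>i<n. 8 * (x ^ 4 + 256 * (exp (r * a i - x) + exp (- (r * a i - x)))) / (real n)\<^sup>2)
      = 8 * (n * x ^ 4 + 256 * (\<Sum>i<n. exp (r * a i - x) + exp (- (r * a i - x)))) / (real n)\<^sup>2"
    unfolding sum_divide_distrib[symmetric] sum_distrib_left[symmetric] sum.distrib[of "\<lambda>_. x ^ 4"] by simp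
  also have "2 / 3 * (real n * \<dots>)
      = 16 / 3 * x ^ 4 + 4096 / (3 * real n) * (\<Sum>i<n. exp (r * a i - x) + exp (- (r * a i - x)))"
    using n by (simp add: power2_eq_square field_simps)
  finally show ?thesis by (simp add: r_def)
qed

text \<open>The mean of the edge gap is bounded by 16/3 * x^4 + 8192/3 * exp (3/2), where 8192 = 2 *
  4096 counts the two signs of the exponential and exp (3/2) bounds each exponential moment. Twice
  the second term dominates both coefficients.\<close>

definition critical_const :: real where
  "critical_const = 16384 / 3 * exp (3 / 2)"

lemma critical_const_pos: "0 < critical_const" by (simp add: critical_const_def)

text \<open>The lower bound restricts the sum to a window of its natural width \<open>sqrt n\<close> around
  \<open>x * sqrt n\<close> and applies Jensen's inequality, in the form of the tangent line of the exponential,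
  to the quartic part of the exponent.\<close>

lemma ergm_Z_ge:
  assumes n: "2 \<le> n" and h: "0 \<le> h" and x: "0 \<le> x"
  shows "ergm_scale n * sqrt n * exp ((real n - 1) * h * sqrt n * x
      - (real n - 1) * n * h\<^sup>2 / 4 - critical_const * (x ^ 4 + 1))
    \<le> ergm_Z n (1 / 2) (vec n (\<lambda>_. h))"
proof -
  let ?M = "PiM {..<n} (\<lambda>_. lborel :: real measure)"
  define c where "c = real n - 1"
  define r where "r = sqrt n"
  have r: "0 < r" and nr: "real n = r * r" using n by (simp_all add: r_def)
  define W where "W = {x * r .. x * r + r}"
  \<comment> \<open>The exponential flattens the standard normal density of the sum, so that the
    measure with density \<open>w\<close> gives the sum a constant density on the window.\<close>
  define f where "f z = exp (z\<^sup>2 / 2) * indicator W z" for z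
  define K where "K = critical_const * (x ^ 4 + 1)"
  define K' where "K' = exp (- real n / 4) * sqrt ((real n - 1) / pi) ^ n * 2 ^ card (edges n)"
  define D where "D = sqrt (2 * pi / n) ^ n / sqrt (2 * pi)"
  have K: "0 \<le> K" "0 \<le> K'" "0 \<le> D" using n critical_const_pos by (simp_all add: K_def K'_def D_def)
  have f: "0 \<le> f z" for z by (simp add: f_def)
  have [measurable]: "W \<in> sets borel" by (simp add: W_def)
  have [measurable]: "f \<in> borel_measurable borel" unfolding f_def by measurable
  define w where "w a = f (\<Sum>i<n. a i) * tilt_weight n (\<lambda>_. 0) a" for a
  have w0: "0 \<le> w a" for a by (simp add: w_def f tilt_weight_def)
  have [measurable]: "w \<in> borel_measurable ?M" unfolding w_def [abs_def] by measurable

  \<comment> \<open>A tilt only multiplies the flat density by at most exp (z * mean), which is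
    controlled on the window.\<close>
  have moment: "(\<integral>\<^sup>+a. ennreal (f (\<Sum>i<n. a i)) * ennreal (tilt_weight n l a) \<partial>?M)
      \<le> ennreal (exp ((\<Sum>i<n. (l i)\<^sup>2) / (2 * real n)) * D * (r * exp C))"
    if "\<And>z. z \<in> W \<Longrightarrow> (\<Sum>i<n. l i) / n * z \<le> C" for l C
  proof -
    define \<Lambda> where "\<Lambda> = (\<Sum>i<n. l i) / n"
    have "ennreal (f z) * ennreal (normal_density \<Lambda> 1 z) \<le> ennreal (exp C / sqrt (2 * pi)) * indicator W z" for z
    proof (cases "z \<in> W")
      case True
      have "z\<^sup>2 / 2 + - (z - \<Lambda>)\<^sup>2 / 2 \<le> \<Lambda> * z" by (simp add: power2_diff field_simps)
      also have "\<dots> \<le> C" using that[OF True] by (simp add: \<Lambda>_def)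
      finally have "exp (z\<^sup>2 / 2) * exp (- (z - \<Lambda>)\<^sup>2 / 2) \<le> exp C"
        unfolding mult_exp_exp by (simp only: exp_le_cancel_iff)
      from divide_right_mono[OF this, of "sqrt (2 * pi)"] show ?thesis
        using True by (simp add: ennreal_mult[symmetric] f_def normal_density_def)
    qed (simp add: f_def)
    then have "(\<integral>\<^sup>+z. ennreal (f z) * ennreal (normal_density \<Lambda> 1 z) \<partial>lborel)
        \<le> (\<integral>\<^sup>+z. ennreal (exp C / sqrt (2 * pi)) * indicator W z \<partial>lborel)"
      by (rule nn_integral_mono)
    also have "\<dots> = ennreal (exp C / sqrt (2 * pi) * r)"
      using r by (simp add: nn_integral_cmult_indicator W_def ennreal_mult[symmetric])
    finally have "(\<integral>\<^sup>+a. ennreal (f (\<Sum>i<n. a i)) * ennreal (tilt_weight n l a) \<partial>?M)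
        \<le> ennreal (exp ((\<Sum>i<n. (l i)\<^sup>2) / (2 * real n)) * sqrt (2 * pi / n) ^ n)
          * ennreal (exp C / sqrt (2 * pi) * r)"
      using n unfolding \<Lambda>_def by (subst nn_integral_tilt_weight) (auto intro!: mult_left_mono)
    also have "\<dots> = ennreal (exp ((\<Sum>i<n. (l i)\<^sup>2) / (2 * real n)) * D * (r * exp C))"
      using r by (simp add: ennreal_mult[symmetric] D_def mult_ac)
    finally show ?thesis .
  qed

  have mass: "(\<integral>\<^sup>+a. ennreal (w a) \<partial>?M) = ennreal (D * r)"
  proof -
    have "f z * normal_density 0 1 z = indicator W z / sqrt (2 * pi)" for z
      by (simp add: f_def normal_density_def mult_exp_exp indicator_def)
    then have "ennreal (f z) * ennreal (normal_density 0 1 z) = ennreal (1 / sqrt (2 * pi)) * indicator W z" for z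
      by (simp add: ennreal_mult[symmetric] f indicator_def)
    then have "(\<integral>\<^sup>+z. ennreal (f z) * ennreal (normal_density 0 1 z) \<partial>lborel) = ennreal (1 / sqrt (2 * pi) * r)"
      using r by (simp add: nn_integral_cmult_indicator W_def ennreal_mult[symmetric])
    moreover have "(\<integral>\<^sup>+a. ennreal (w a) \<partial>?M) = ennreal (sqrt (2 * pi / n) ^ n)
        * (\<integral>\<^sup>+z. ennreal (f z) * ennreal (normal_density 0 1 z) \<partial>lborel)"
      using nn_integral_tilt_weight[of n "\<lambda>z. ennreal (f z)" "\<lambda>_. 0"] n
      by (simp add: w_def ennreal_mult f tilt_weight_def)
    ultimately show ?thesis using r by (simp add: ennreal_mult[symmetric] D_def)
  qed

  have exp_moment: "(\<integral>\<^sup>+a. ennreal (w a * exp (s * (r * a i - x))) \<partial>?M) \<le> ennreal (D * r * exp (3 / 2))"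
    if i: "i < n" and s: "s = 1 \<or> s = - 1" for i s
  proof -
    \<comment> \<open>A tilt of the single coordinate \<open>i\<close> by sqrt n has Gaussian cost
      exp (1/2) and shifts the sum by only s / sqrt n. Over a window of width sqrt n this varies by
      a factor of at most exp 1, hence the total exp (3/2).\<close>
    define l where "l j = (if j = i then s * r else 0)" for j
    have l: "(\<Sum>j<n. (l j)\<^sup>2) / (2 * real n) = 1 / 2" "(\<Sum>j<n. l j) / n = s / r"
      "(\<Sum>j<n. l j * a j) = s * r * a i" for a
      using i s r by (auto simp: l_def nr power2_eq_square if_distrib[of "\<lambda>t. t * _"] cong: if_cong)
    have tilt: "tilt_weight n l a = tilt_weight n (\<lambda>_. 0) a * exp (s * r * a i)" for a
      unfolding tilt_weight_def mult_exp_exp by (simp add: sum_subtractf l sum_negf)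
    have "(\<integral>\<^sup>+a. ennreal (w a * exp (s * (r * a i - x))) \<partial>?M)
        = (\<integral>\<^sup>+a. ennreal (exp (- (s * x))) * (ennreal (f (\<Sum>i<n. a i)) * ennreal (tilt_weight n l a)) \<partial>?M)"
    proof (rule nn_integral_cong)
      fix a :: "nat \<Rightarrow> real"
      have "w a * exp (s * (r * a i - x)) = exp (- (s * x)) * (f (\<Sum>i<n. a i) * tilt_weight n l a)"
        unfolding w_def tilt right_diff_distrib exp_diff exp_minus by (simp add: field_simps)
      moreover have "0 \<le> tilt_weight n l a" by (simp add: tilt_weight_def)
      ultimately show "ennreal (w a * exp (s * (r * a i - x)))
          = ennreal (exp (- (s * x))) * (ennreal (f (\<Sum>i<n. a i)) * ennreal (tilt_weight n l a))"
        by (simp add: ennreal_mult f)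
    qed
    also have "\<dots> = ennreal (exp (- (s * x))) * (\<integral>\<^sup>+a. ennreal (f (\<Sum>i<n. a i)) * ennreal (tilt_weight n l a) \<partial>?M)"
      by (rule nn_integral_cmult) measurable
    also have "\<dots> \<le> ennreal (exp (- (s * x))) * ennreal (exp (1 / 2) * D * (r * exp (s * x + 1)))"
    proof (intro mult_left_mono)
      have "s / r * z \<le> s * x + 1" if "z \<in> W" for z
        using that s r unfolding W_def by (auto simp: field_simps)
      then show "(\<integral>\<^sup>+a. ennreal (f (\<Sum>i<n. a i)) * ennreal (tilt_weight n l a) \<partial>?M)
          \<le> ennreal (exp (1 / 2) * D * (r * exp (s * x + 1)))"
        using moment[of l "s * x + 1"] unfolding l by simp
    qed simp
    also have "\<dots> = ennreal (D * r * (exp (- (s * x)) * exp (1 / 2) * exp (s * x + 1)))"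
      using K r by (simp add: ennreal_mult[symmetric] mult_ac)
    also have "exp (- (s * x)) * exp (1 / 2) * exp (s * x + 1) = exp (3 / 2)"
      unfolding mult_exp_exp by simp
    finally show ?thesis .
  qed

  have gap: "(\<integral>\<^sup>+a. ennreal (w a * edge_gap n a) \<partial>?M) \<le> ennreal (K * (D * r))"
  proof -
    have "(\<integral>\<^sup>+a. ennreal (w a * edge_gap n a) \<partial>?M)
        \<le> (\<integral>\<^sup>+a. ennreal (16 / 3 * x ^ 4) * ennreal (w a) + ennreal (4096 / (3 * real n))
          * (\<Sum>i<n. ennreal (w a * exp (1 * (r * a i - x))) + ennreal (w a * exp (- 1 * (r * a i - x)))) \<partial>?M)"
    proof (rule nn_integral_mono)
      fix a :: "nat \<Rightarrow> real"
      have "w a * edge_gap n a \<le> w a * (16 / 3 * x ^ 4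
          + 4096 / (3 * real n) * (\<Sum>i<n. exp (r * a i - x) + exp (- (r * a i - x))))"
        unfolding r_def using n by (intro mult_left_mono[OF edge_gap_le w0]) simp
      also have "\<dots> = 16 / 3 * x ^ 4 * w a
          + 4096 / (3 * real n) * (\<Sum>i<n. w a * exp (1 * (r * a i - x)) + w a * exp (- 1 * (r * a i - x)))"
        by (simp add: distrib_left sum_distrib_left sum_divide_distrib mult_ac)
      finally show "ennreal (w a * edge_gap n a) \<le> ennreal (16 / 3 * x ^ 4) * ennreal (w a) + ennreal (4096 / (3 * real n))
          * (\<Sum>i<n. ennreal (w a * exp (1 * (r * a i - x))) + ennreal (w a * exp (- 1 * (r * a i - x))))"
        using w0[of a] by (simp add: ennreal_plus[symmetric] ennreal_mult[symmetric] sum_nonneg del: ennreal_plus)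
    qed
    also have "\<dots> = ennreal (16 / 3 * x ^ 4) * (\<integral>\<^sup>+a. ennreal (w a) \<partial>?M) + ennreal (4096 / (3 * real n))
          * (\<Sum>i<n. (\<integral>\<^sup>+a. ennreal (w a * exp (1 * (r * a i - x))) \<partial>?M)
            + (\<integral>\<^sup>+a. ennreal (w a * exp (- 1 * (r * a i - x))) \<partial>?M))"
      by (simp add: nn_integral_add nn_integral_cmult nn_integral_sum)
    also have "\<dots> \<le> ennreal (16 / 3 * x ^ 4) * ennreal (D * r) + ennreal (4096 / (3 * real n))
          * (\<Sum>i<n. ennreal (D * r * exp (3 / 2)) + ennreal (D * r * exp (3 / 2)))"
      unfolding mass by (intro add_mono mult_left_mono sum_mono exp_moment) auto
    also have "\<dots> = ennreal (16 / 3 * x ^ 4 * (D * r) + 4096 / (3 * real n) * (\<Sum>i<n. D * r * exp (3 / 2) + D * r * exp (3 / 2)))"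
      using K r by (simp add: sum_nonneg ennreal_plus[symmetric] ennreal_mult[symmetric] del: ennreal_plus sum_constant)
    also have "16 / 3 * x ^ 4 * (D * r) + 4096 / (3 * real n) * (\<Sum>i<n. D * r * exp (3 / 2) + D * r * exp (3 / 2))
        = (16 / 3 * x ^ 4 + 8192 / 3 * exp (3 / 2)) * (D * r)"
      using n by (simp add: field_simps)
    also have "ennreal \<dots> \<le> ennreal (K * (D * r))"
    proof (intro ennreal_leI mult_right_mono)
      have "16 / 3 \<le> critical_const"
        using exp_ge_add_one_self[of "3 / 2"] by (simp add: critical_const_def)
      then have "16 / 3 * x ^ 4 \<le> critical_const * x ^ 4" by (intro mult_right_mono) auto
      moreover have "8192 / 3 * exp (3 / 2) \<le> critical_const" by (simp add: critical_const_def)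
      ultimately show "16 / 3 * x ^ 4 + 8192 / 3 * exp (3 / 2) \<le> K" by (simp add: K_def distrib_left)
    qed (use K r in simp)
    finally show ?thesis .
  qed

  have lower: "ennreal (exp (- K) * (D * r)) \<le> (\<integral>\<^sup>+a. ennreal (w a * exp (- edge_gap n a)) \<partial>?M)" (is "_ \<le> ?X")
  proof -
    \<comment> \<open>The tangent of the exponential at - K, with \<open>K\<close> an upper bound
      for the mean gap. All terms are arranged as sums, since subtraction in \<open>ennreal\<close>
      is truncated.\<close>
    have "ennreal (exp (- K) * (1 + K) * (D * r)) = (\<integral>\<^sup>+a. ennreal (exp (- K) * (1 + K)) * ennreal (w a) \<partial>?M)"
      using K r by (simp add: nn_integral_cmult mass ennreal_mult[symmetric])
    also have "\<dots> \<le> (\<integral>\<^sup>+a. ennreal (w a * exp (- edge_gap n a)) + ennreal (exp (- K)) * ennreal (w a * edge_gap n a) \<partial>?M)"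
    proof (rule nn_integral_mono)
      fix a :: "nat \<Rightarrow> real"
      have "exp (- K) * (1 + (K - edge_gap n a)) \<le> exp (- K) * exp (K - edge_gap n a)"
        by (intro mult_left_mono exp_ge_add_one_self) auto
      then have "exp (- K) * (1 + K) \<le> exp (- edge_gap n a) + exp (- K) * edge_gap n a"
        unfolding mult_exp_exp by (simp add: algebra_simps)
      from mult_left_mono[OF this w0[of a]]
      show "ennreal (exp (- K) * (1 + K)) * ennreal (w a)
          \<le> ennreal (w a * exp (- edge_gap n a)) + ennreal (exp (- K)) * ennreal (w a * edge_gap n a)"
        using K w0[of a] edge_gap_nonneg[of n a]
        by (simp add: ennreal_plus[symmetric] ennreal_mult[symmetric] algebra_simps del: ennreal_plus)
    qed
    also have "\<dots> = ?X + ennreal (exp (- K)) * (\<integral>\<^sup>+a. ennreal (w a * edge_gap n a) \<partial>?M)"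
      by (simp add: nn_integral_add nn_integral_cmult)
    also have "\<dots> \<le> ?X + ennreal (exp (- K)) * ennreal (K * (D * r))"
      by (intro add_left_mono mult_left_mono gap) auto
    finally have le: "ennreal (exp (- K) * (1 + K) * (D * r)) \<le> ?X + ennreal (exp (- K) * (K * (D * r)))"
      using K r by (simp add: ennreal_mult[symmetric])
    show ?thesis
    proof (cases ?X)
      case (real X)
      then have "exp (- K) * (1 + K) * (D * r) \<le> X + exp (- K) * (K * (D * r))"
        using le K r by (simp add: ennreal_plus[symmetric] del: ennreal_plus)
      then show ?thesis using real by (simp add: ennreal_leI algebra_simps)
    qed simp
  qed

  define H where "H = exp (c * h * (x * r))"
  have "ennreal H * ennreal (exp (- K) * (D * r))
      \<le> ennreal H * (\<integral>\<^sup>+a. ennreal (w a * exp (- edge_gap n a)) \<partial>?M)"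
    by (intro mult_left_mono lower) auto
  also have "\<dots> = (\<integral>\<^sup>+a. ennreal H * ennreal (w a * exp (- edge_gap n a)) \<partial>?M)"
    by (rule nn_integral_cmult[symmetric]) measurable
  also have "\<dots> \<le> (\<integral>\<^sup>+a. ennreal (exp ((\<Sum>i<n. a i)\<^sup>2 / 2 - edge_gap n a)) * ennreal (tilt_weight n (\<lambda>i. c * h) a) \<partial>?M)"
  proof (rule nn_integral_mono)
    fix a :: "nat \<Rightarrow> real"
    define S where "S = (\<Sum>i<n. a i)"
    have tilt: "tilt_weight n (\<lambda>i. c * h) a = exp (c * h * S) * tilt_weight n (\<lambda>_. 0) a"
      unfolding tilt_weight_def S_def mult_exp_exp by (simp add: sum_subtractf sum_distrib_left sum_negf)
    have "H * (w a * exp (- edge_gap n a)) \<le> exp (S\<^sup>2 / 2 - edge_gap n a) * tilt_weight n (\<lambda>i. c * h) a"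
    proof (cases "S \<in> W")
      case True
      \<comment> \<open>As h \<ge> 0, the tilt is smallest at the left end of the window.\<close>
      then have "c * h * (x * r) \<le> c * h * S"
        using h n by (intro mult_left_mono) (auto simp: W_def c_def)
      then have "H \<le> exp (c * h * S)" by (simp add: H_def)
      then have "H * (exp (S\<^sup>2 / 2 - edge_gap n a) * tilt_weight n (\<lambda>_. 0) a)
          \<le> exp (c * h * S) * (exp (S\<^sup>2 / 2 - edge_gap n a) * tilt_weight n (\<lambda>_. 0) a)"
        by (intro mult_right_mono) (auto simp: tilt_weight_def)
      moreover have "exp (S\<^sup>2 / 2 - edge_gap n a) = exp (S\<^sup>2 / 2) * exp (- edge_gap n a)"
        by (simp add: mult_exp_exp)
      ultimately show ?thesis
        using True unfolding tilt by (simp add: w_def f_def S_def[symmetric] mult_ac)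
    qed (simp add: w_def f_def S_def[symmetric] tilt_weight_def)
    then show "ennreal H * ennreal (w a * exp (- edge_gap n a))
        \<le> ennreal (exp ((\<Sum>i<n. a i)\<^sup>2 / 2 - edge_gap n a)) * ennreal (tilt_weight n (\<lambda>i. c * h) a)"
      using w0[of a] by (simp add: ennreal_mult[symmetric] S_def H_def tilt_weight_def ennreal_leI)
  qed
  finally have "ennreal (K' * exp (- c / 4 * (n * h\<^sup>2))) * (ennreal H * ennreal (exp (- K) * (D * r)))
      \<le> ennreal (ergm_Z n (1 / 2) (vec n (\<lambda>_. h)))"
    using ergm_Z_eq_nn_integral[OF n, of "\<lambda>_. h"] unfolding K'_def c_def by (simp add: mult_left_mono)
  then have "K' * exp (- c / 4 * (n * h\<^sup>2)) * (H * (exp (- K) * (D * r))) \<le> ergm_Z n (1 / 2) (vec n (\<lambda>_. h))"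
    using K r ergm_Z_pos[of n "1 / 2" "vec n (\<lambda>_. h)"] by (simp add: ennreal_mult[symmetric] H_def less_imp_le)
  also have "K' * exp (- c / 4 * (n * h\<^sup>2)) * (H * (exp (- K) * (D * r)))
      = ergm_scale n * r * (exp (c * h * (x * r)) * exp (- c / 4 * (n * h\<^sup>2)) * exp (- K))"
    by (simp add: ergm_scale_def K'_def D_def H_def)
  also have "exp (c * h * (x * r)) * exp (- c / 4 * (n * h\<^sup>2)) * exp (- K)
      = exp ((real n - 1) * h * sqrt n * x - (real n - 1) * n * h\<^sup>2 / 4 - critical_const * (x ^ 4 + 1))"
  proof -
    have "- c / 4 * (n * h\<^sup>2) = - (c * n * h\<^sup>2 / 4)" "c * h * (x * r) = c * h * r * x"
      by simp_all
    then show ?thesis unfolding mult_exp_exp K_def[symmetric] c_def[symmetric] r_def[symmetric] by simp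
  qed
  finally show ?thesis by (simp add: r_def)
qed

section \<open>Ratios of partition functions\<close>

text \<open>The first two factors come from the upper bound, the last one from the constant part of
  the quartic cost in the lower bound.\<close>

definition ratio_const :: real where
  "ratio_const = 2 * exp (16 / 3) * exp critical_const"

lemma ratio_const_ge_1: "1 \<le> ratio_const"
proof -
  have "1 \<le> exp (16 / 3 :: real)" "1 \<le> exp critical_const"
    using critical_const_pos by simp_all
  then have "1 * 1 * 1 \<le> 2 * exp (16 / 3 :: real) * exp critical_const"
    by (intro mult_mono) auto
  then show ?thesis by (simp add: ratio_const_def)
qed

text \<open>The common factor \<open>ergm_scale n * sqrt n\<close> cancels. The position
  \<open>x\<close> of the window remains free: 0 suffices for comparison with the null law, and a
  large value exploits a signal in the denominator.\<close>

lemma ergm_Z_ratio_le: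
  assumes n: "64 \<le> n" and b: "\<bar>\<Sum>i<n. b i\<bar> * sqrt n \<le> 1" and h: "0 \<le> h" and x: "0 \<le> x"
  shows "ergm_Z n (1 / 2) (vec n b) / ergm_Z n (1 / 2) (vec n (\<lambda>_. h))
    \<le> ratio_const * exp (n / 4 * (\<Sum>i<n. (b i)\<^sup>2) - (real n - 1) * h * sqrt n * x
        + (real n - 1) * n * h\<^sup>2 / 4 + critical_const * x ^ 4)"
proof -
  define P where "P = ergm_scale n * sqrt n"
  define u where "u = n / 4 * (\<Sum>i<n. (b i)\<^sup>2)"
  define v where "v = (real n - 1) * h * sqrt n * x - (real n - 1) * n * h\<^sup>2 / 4 - critical_const * (x ^ 4 + 1)"
  have P: "0 < P" using n ergm_scale_pos[of n] by (simp add: P_def)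
  have "ergm_Z n (1 / 2) (vec n b) / ergm_Z n (1 / 2) (vec n (\<lambda>_. h))
      \<le> (P * (2 * exp (16 / 3)) * exp u) / (P * exp v)"
    using ergm_Z_le[OF n b] ergm_Z_ge[OF _ h x, of n] n P
    by (intro frac_le) (auto simp: P_def u_def v_def)
  also have "\<dots> = 2 * exp (16 / 3) * exp (u - v)" using P by (simp add: exp_diff)
  also have "u - v = critical_const + (u - (real n - 1) * h * sqrt n * x
        + (real n - 1) * n * h\<^sup>2 / 4 + critical_const * x ^ 4)"
    by (simp add: v_def algebra_simps)
  finally show ?thesis by (simp only: exp_add[of critical_const] ratio_const_def u_def mult.assoc)
qed

lemma vec_0_eq: "0\<^sub>v n = vec n (\<lambda>_. 0)" by auto

lemma ergm_Z_ratio_null_le: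
  assumes n: "64 \<le> n" and b: "\<bar>\<Sum>i<n. b i\<bar> * sqrt n \<le> 1"
  shows "ergm_Z n (1 / 2) (vec n b) / ergm_Z n (1 / 2) (0\<^sub>v n)
    \<le> ratio_const * exp (n / 4 * (\<Sum>i<n. (b i)\<^sup>2))"
  using ergm_Z_ratio_le[OF assms, of 0 0] by (simp add: vec_0_eq)

section \<open>The two errors of the total degree test\<close>

lemma prob_null_total_degree_gt:
  assumes n: "64 \<le> n"
  shows "measure_pmf.prob (ergm n (1 / 2) (0\<^sub>v n)) {Y. L < (\<Sum>i<n. node_degree Y i)}
    \<le> ratio_const * exp (1 / 4) * exp (- (L / (n * sqrt n)) / 2)"
proof -
  define h where "h = 1 / (n * sqrt n)"
  have h: "0 < h" using n by (simp add: h_def)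
  have sq: "(\<Sum>i<n. h\<^sup>2) \<le> 1 / n" "\<bar>\<Sum>i<n. h\<bar> * sqrt n \<le> 1"
    using n by (simp_all add: h_def power_mult_distrib power_divide power2_eq_square field_simps)
  have "measure_pmf.prob (ergm n (1 / 2) (0\<^sub>v n)) {Y. L < (\<Sum>i<n. node_degree Y i)}
      \<le> exp (- (h / 2 * L)) * ergm_Z n (1 / 2) (vec n (\<lambda>i. 0\<^sub>v n $ i + 2 * (h / 2))) / ergm_Z n (1 / 2) (0\<^sub>v n)"
    using h by (intro ergm_chernoff) simp
  also have "vec n (\<lambda>i. 0\<^sub>v n $ i + 2 * (h / 2)) = vec n (\<lambda>_. h)" by auto
  also have "exp (- (h / 2 * L)) * ergm_Z n (1 / 2) (vec n (\<lambda>_. h)) / ergm_Z n (1 / 2) (0\<^sub>v n)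
      = exp (- (h / 2 * L)) * (ergm_Z n (1 / 2) (vec n (\<lambda>_. h)) / ergm_Z n (1 / 2) (0\<^sub>v n))" by simp
  also have "\<dots> \<le> exp (- (h / 2 * L)) * (ratio_const * exp (n / 4 * (\<Sum>i<n. h\<^sup>2)))"
    using n by (intro mult_left_mono ergm_Z_ratio_null_le sq) auto
  also have "\<dots> \<le> exp (- (h / 2 * L)) * (ratio_const * exp (1 / 4))"
  proof -
    have "n / 4 * (\<Sum>i<n. h\<^sup>2) \<le> n / 4 * (1 / n)" by (intro mult_left_mono sq) auto
    then show ?thesis using n ratio_const_ge_1 by (intro mult_left_mono) auto
  qed
  finally show ?thesis by (simp add: h_def mult_ac)
qed

text \<open>The shift by minus the mean \<open>h\<close> leaves a centred parameter vector in the
  numerator. The cost of the threshold is \<omega>^5 / 2, the gain from the denominator at least 3/2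
  * \<omega>^5.\<close>

lemma prob_total_degree_le:
  fixes A \<omega> :: real
  assumes n: "64 \<le> n" and S: "S \<subseteq> {..<n}" and \<omega>: "0 \<le> \<omega>"
    and \<tau>: "\<omega> ^ 4 = A * card S * sqrt n" and A: "0 \<le> A" and bd: "\<omega> ^ 8 \<le> card S"
  shows "measure_pmf.prob (ergm n (1 / 2) (vec n (\<lambda>i. if i \<in> S then A else 0)))
      {Y. (\<Sum>i<n. node_degree Y i) \<le> \<omega> * (n * sqrt n)}
    \<le> ratio_const * exp (1 / 2 - \<omega> ^ 5 + 81 * critical_const * \<omega> ^ 4)"
proof -
  define b where "b i = (if i \<in> S then A else 0)" for i
  define h where "h = A * card S / n"
  define L where "L = \<omega> * (n * sqrt n)"
  have fin: "finite S" using S finite_subset by blast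
  have sum_b: "(\<Sum>i<n. b i) = A * card S" and sum_b2: "(\<Sum>i<n. (b i)\<^sup>2) = A\<^sup>2 * card S"
    using S by (simp_all add: b_def sum.If_cases if_distrib[of "\<lambda>x. x\<^sup>2"] Int_absorb1 cong: if_cong)
  have h0: "0 \<le> h" using A by (simp add: h_def)
  have hn: "h * n * sqrt n = \<omega> ^ 4" using n by (simp add: h_def \<tau>)
  have card_le: "real (card S) \<le> n" using card_mono[OF _ S] by simp
  have tau2: "(h * n)\<^sup>2 * n = \<omega> ^ 8"
    using arg_cong[OF hn, of "\<lambda>x. x\<^sup>2"] by (simp add: power_mult_distrib power_mult[symmetric])
  have b0: "\<bar>\<Sum>i<n. b i - h\<bar> * sqrt n \<le> 1"
    using n by (simp add: sum_subtractf sum_b h_def)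
  have "measure_pmf.prob (ergm n (1 / 2) (vec n b)) {Y. (\<Sum>i<n. node_degree Y i) \<le> L}
      \<le> exp (- (- (h / 2) * L)) * ergm_Z n (1 / 2) (vec n (\<lambda>i. vec n b $ i + 2 * - (h / 2))) / ergm_Z n (1 / 2) (vec n b)"
    using h0 by (intro ergm_chernoff) (auto intro!: mult_nonneg_nonneg simp: mult_le_0_iff)
  also have "vec n (\<lambda>i. vec n b $ i + 2 * - (h / 2)) = vec n (\<lambda>i. b i - h)" by auto
  also have "exp (- (- (h / 2) * L)) * ergm_Z n (1 / 2) (vec n (\<lambda>i. b i - h)) / ergm_Z n (1 / 2) (vec n b)
      \<le> exp (- (- (h / 2) * L)) * ergm_Z n (1 / 2) (vec n (\<lambda>i. b i - h)) / ergm_Z n (1 / 2) (vec n (\<lambda>_. h))"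
    using ergm_Z_mean_le[of n "1 / 2" b] n ergm_Z_pos
    by (intro divide_left_mono) (auto simp: sum_b h_def less_imp_le)
  also have "\<dots> = exp (h / 2 * L) * (ergm_Z n (1 / 2) (vec n (\<lambda>i. b i - h)) / ergm_Z n (1 / 2) (vec n (\<lambda>_. h)))"
    by simp
  \<comment> \<open>The window is placed at x = 3 * \<omega>: even after n - 1 is weakened to n / 2,
    the linear gain exceeds the cost of the threshold by \<omega>^5. The price is the factor 81 =
    3^4 in the quartic term.\<close>
  also have "\<dots> \<le> exp (h / 2 * L) * (ratio_const * exp (n / 4 * (\<Sum>i<n. (b i - h)\<^sup>2)
      - (real n - 1) * h * sqrt n * (3 * \<omega>) + (real n - 1) * n * h\<^sup>2 / 4 + critical_const * (3 * \<omega>) ^ 4))"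
    using \<omega> by (intro mult_left_mono ergm_Z_ratio_le n b0 h0) auto
  also have "\<dots> = ratio_const * exp (h / 2 * L + (n / 4 * (\<Sum>i<n. (b i - h)\<^sup>2)
      - (real n - 1) * h * sqrt n * (3 * \<omega>) + (real n - 1) * n * h\<^sup>2 / 4 + critical_const * (3 * \<omega>) ^ 4))"
    by (simp only: exp_add mult_ac)
  also have "\<dots> \<le> ratio_const * exp (1 / 2 - \<omega> ^ 5 + 81 * critical_const * \<omega> ^ 4)"
  proof -
    have "h / 2 * L = \<omega> ^ 5 / 2"
      using hn[symmetric] by (simp add: L_def eval_nat_numeral mult_ac)
    moreover have "n / 4 * (\<Sum>i<n. (b i - h)\<^sup>2) \<le> 1 / 4"
    proof -
      have "(\<Sum>i<n. (b i - h)\<^sup>2) = A\<^sup>2 * card S - 2 * h * (A * card S) + n * h\<^sup>2"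
        by (simp add: power2_diff sum.distrib sum_subtractf sum_b2 sum_b[symmetric] sum_distrib_left mult_ac)
      also have "A * card S = h * n" using n by (simp add: h_def)
      finally have "(\<Sum>i<n. (b i - h)\<^sup>2) \<le> A\<^sup>2 * card S"
        using h0 by (simp add: power2_eq_square)
      then have "n / 4 * (\<Sum>i<n. (b i - h)\<^sup>2) \<le> n / 4 * (A\<^sup>2 * card S)" by (intro mult_left_mono) auto
      \<comment> \<open>The left side equals \<omega>^8 / card S, which is the reason for the bound
        on \<omega>^8.\<close>
      moreover have "n * (A\<^sup>2 * card S) \<le> 1"
      proof (cases "card S = 0")
        case False
        have "n * (A\<^sup>2 * card S) * card S = (A * card S * sqrt n)\<^sup>2"
          by (simp add: power_mult_distrib power2_eq_square mult_ac)
        also have "\<dots> = \<omega> ^ 8" by (simp add: \<tau>[symmetric] power_mult[symmetric])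
        finally have "n * (A\<^sup>2 * card S) * card S \<le> 1 * real (card S)" using bd by simp
        then show ?thesis using False by (simp only: mult_le_cancel_right_pos of_nat_0_less_iff neq0_conv)
      qed simp
      ultimately show ?thesis by simp
    qed
    moreover have "3 / 2 * \<omega> ^ 5 \<le> (real n - 1) * h * sqrt n * (3 * \<omega>)"
    proof -
      have "3 / 2 * \<omega> ^ 5 = (n / 2) * (h * sqrt n * (3 * \<omega>))"
        using hn[symmetric] by (simp add: eval_nat_numeral mult_ac)
      also have "\<dots> \<le> (real n - 1) * (h * sqrt n * (3 * \<omega>))"
        using n h0 \<omega> by (intro mult_right_mono) auto
      finally show ?thesis by (simp add: mult_ac)
    qed
    moreover have "(real n - 1) * n * h\<^sup>2 / 4 \<le> 1 / 4"
    proof -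
      have "(h * n)\<^sup>2 * n \<le> 1 * real n" using tau2 bd card_le by simp
      then have "(h * n)\<^sup>2 \<le> 1" using n by simp
      moreover have "(real n - 1) * n * h\<^sup>2 \<le> n * n * h\<^sup>2"
        by (intro mult_right_mono) (auto simp: algebra_simps)
      ultimately have "(real n - 1) * n * h\<^sup>2 \<le> 1" by (simp add: power2_eq_square mult_ac)
      then show ?thesis by simp
    qed
    moreover have "critical_const * (3 * \<omega>) ^ 4 = 81 * critical_const * \<omega> ^ 4"
      by (simp add: power_mult_distrib)
    ultimately have "h / 2 * L + (n / 4 * (\<Sum>i<n. (b i - h)\<^sup>2)
        - (real n - 1) * h * sqrt n * (3 * \<omega>) + (real n - 1) * n * h\<^sup>2 / 4 + critical_const * (3 * \<omega>) ^ 4)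
      \<le> 1 / 2 - \<omega> ^ 5 + 81 * critical_const * \<omega> ^ 4"
      by linarith
    then show ?thesis using ratio_const_ge_1 by (intro mult_left_mono) auto
  qed
  finally show ?thesis by (simp add: b_def [abs_def] L_def)
qed

lemma alternative_prob_total_degree_le:
  assumes n: "64 \<le> n" and \<beta>: "\<beta> \<in> alternative n s A" and s: "0 < s" and \<omega>: "0 \<le> \<omega>"
    and A: "\<omega> ^ 4 \<le> A * s * sqrt n" and bd: "\<omega> ^ 8 \<le> s"
  shows "measure_pmf.prob (ergm n (1 / 2) \<beta>) {Y. (\<Sum>i<n. node_degree Y i) \<le> \<omega> * (n * sqrt n)}
    \<le> ratio_const * exp (1 / 2 - \<omega> ^ 5 + 81 * critical_const * \<omega> ^ 4)"
proof -
  define S where "S = vec_supp \<beta>"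
  \<comment> \<open>The signal is cut down so that its effective strength is exactly \<omega>^4, on
    the true support of \<beta>. A support larger than \<open>s\<close> only makes \<open>A'\<close>
    smaller, so it stays below \<open>A\<close>.\<close>
  define A' where "A' = \<omega> ^ 4 / (card S * sqrt n)"
  have \<beta>': "\<beta> \<in> carrier_vec n" "s \<le> card S" "\<And>i. i \<in> S \<Longrightarrow> A \<le> \<beta> $ i"
    using \<beta> by (auto simp: alternative_def S_def)
  have S: "S \<subseteq> {..<n}" using \<beta>'(1) by (auto simp: S_def vec_supp_def)
  have cS: "0 < real (card S)" using s \<beta>'(2) by linarith
  have A'0: "0 \<le> A'" using \<omega> by (simp add: A'_def)
  have "A' \<le> \<omega> ^ 4 / (s * sqrt n)"
    unfolding A'_def using n s \<beta>'(2) \<omega> by (intro divide_left_mono mult_right_mono) auto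
  also have "\<dots> \<le> A" using A s n by (simp add: divide_le_eq mult_ac)
  finally have A'A: "A' \<le> A" .
  have "measure_pmf.prob (ergm n (1 / 2) \<beta>) {Y. (\<Sum>i<n. node_degree Y i) \<le> \<omega> * (n * sqrt n)}
      \<le> measure_pmf.prob (ergm n (1 / 2) (vec n (\<lambda>i. if i \<in> S then A' else 0)))
        {Y. (\<Sum>i<n. node_degree Y i) \<le> \<omega> * (n * sqrt n)}"
  proof (rule prob_total_degree_antimono)
    fix i assume i: "i < n"
    show "vec n (\<lambda>i. if i \<in> S then A' else 0) $ i \<le> \<beta> $ i"
    proof (cases "i \<in> S")
      case True
      then show ?thesis using i A'A \<beta>'(3)[OF True] by simp
    next
      case False
      then have "\<beta> $ i = 0" using i \<beta>'(1) by (auto simp: S_def vec_supp_def)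
      then show ?thesis using i False by simp
    qed
  qed (use n in auto)
  also have "\<dots> \<le> ratio_const * exp (1 / 2 - \<omega> ^ 5 + 81 * critical_const * \<omega> ^ 4)"
    using n cS bd \<beta>'(2) by (intro prob_total_degree_le S \<omega> A'0) (auto simp: A'_def)
  finally show ?thesis .
qed

section \<open>Bounds for the risk\<close>

lemma exists_support:
  assumes "0 \<le> s" "s \<le> real n" "0 < A"
  obtains S where "S \<subseteq> {..<n}" "card S = nat \<lceil>s\<rceil>" "vec n (\<lambda>i. if i \<in> S then A else 0) \<in> alternative n s A"
proof -
  have "nat \<lceil>s\<rceil> \<le> card {..<n}" using assms by (simp add: nat_le_iff ceiling_le_iff)
  then obtain S where S: "S \<subseteq> {..<n}" "card S = nat \<lceil>s\<rceil>" by (meson obtain_subset_with_card_n)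
  have "vec_supp (vec n (\<lambda>i. if i \<in> S then A else 0)) = S"
    using S(1) assms(3) by (auto simp: vec_supp_def split: if_splits)
  moreover have "s \<le> real (card S)" unfolding S(2) using assms(1) by linarith
  ultimately have "vec n (\<lambda>i. if i \<in> S then A else 0) \<in> alternative n s A"
    using S by (auto simp: alternative_def)
  with S show thesis by (rule that)
qed

lemma risk_ge:
  assumes n: "64 \<le> n" and T: "is_test n T" and s: "1 \<le> s" "s \<le> real n" and A: "0 < A"
    and small: "2 * (A * s * sqrt n) \<le> 1"
  shows "1 / (2 * (ratio_const * exp (1 / 4))) \<le> risk n (1 / 2) s A T"
proof -
  obtain S where S: "S \<subseteq> {..<n}" "card S = nat \<lceil>s\<rceil>"
    and alt: "vec n (\<lambda>i. if i \<in> S then A else 0) \<in> alternative n s A"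
    using exists_support[of s n A] s A by auto
  define b where "b i = (if i \<in> S then A else 0)" for i
  \<comment> \<open>Rounding \<open>s\<close> up at most doubles it because s \<ge> 1; the factor 2
    in the smallness assumption pays for this.\<close>
  have c: "1 \<le> real (card S)" "real (card S) \<le> 2 * s" unfolding S(2) using s by linarith+
  have sum_b: "(\<Sum>i<n. b i) = A * card S" and sum_b2: "(\<Sum>i<n. (b i)\<^sup>2) = A\<^sup>2 * card S"
    using S(1) by (simp_all add: b_def sum.If_cases if_distrib[of "\<lambda>x. x\<^sup>2"] Int_absorb1 cong: if_cong)
  have \<tau>: "A * card S * sqrt n \<le> 1"
  proof -
    have "A * card S * sqrt n \<le> A * (2 * s) * sqrt n"
      using A c by (intro mult_left_mono mult_right_mono) auto
    then show ?thesis using small by (simp add: mult_ac)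
  qed
  \<comment> \<open>A nonempty support allows squaring its size, so the quadratic cost is controlled
    by the effective signal alone.\<close>
  have "n * (A\<^sup>2 * card S) \<le> n * (A\<^sup>2 * (card S)\<^sup>2)"
    using c by (intro mult_left_mono) (auto simp: power2_eq_square)
  also have "\<dots> = (A * card S * sqrt n)\<^sup>2" by (simp add: power_mult_distrib mult_ac)
  also have "\<dots> \<le> 1" using \<tau> A by (simp add: power_le_one)
  finally have sq: "n / 4 * (A\<^sup>2 * card S) \<le> 1 / 4" by simp
  have "ergm_Z n (1 / 2) (vec n b) / ergm_Z n (1 / 2) (0\<^sub>v n) \<le> ratio_const * exp (n / 4 * (\<Sum>i<n. (b i)\<^sup>2))"
    using \<tau> A by (intro ergm_Z_ratio_null_le n) (simp add: sum_b abs_mult)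
  also have "\<dots> \<le> ratio_const * exp (1 / 4)"
    unfolding sum_b2 using sq ratio_const_ge_1 by (intro mult_left_mono) auto
  finally have "ergm_Z n (1 / 2) (vec n b) \<le> ratio_const * exp (1 / 4) * ergm_Z n (1 / 2) (0\<^sub>v n)"
    using ergm_Z_pos by (simp add: divide_le_eq)
  moreover have "1 * 1 \<le> ratio_const * exp (1 / 4 :: real)"
    using ratio_const_ge_1 by (intro mult_mono) auto
  ultimately show ?thesis
    using alt by (intro risk_lower_bound[OF T]) (auto simp: b_def [abs_def])
qed

lemma risk_total_degree_test_le:
  assumes n: "64 \<le> n" and s: "0 < s" "s \<le> real n" and A0: "0 < A" and \<omega>: "0 \<le> \<omega>"
    and A: "\<omega> ^ 4 \<le> A * s * sqrt n" and bd: "\<omega> ^ 8 \<le> s"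
  shows "risk n (1 / 2) s A (total_degree_test n (\<omega> * (n * sqrt n)))
    \<le> ratio_const * exp (1 / 4) * exp (- \<omega> / 2)
      + ratio_const * exp (1 / 2 - \<omega> ^ 5 + 81 * critical_const * \<omega> ^ 4)"
proof -
  let ?L = "\<omega> * (n * sqrt n)"
  have 1: "{Y. total_degree_test n ?L Y = 1} = {Y. ?L < (\<Sum>i<n. node_degree Y i)}"
    and 0: "{Y. total_degree_test n ?L Y = 0} = {Y. (\<Sum>i<n. node_degree Y i) \<le> ?L}"
    by (auto simp: total_degree_test_def)
  have "alternative n s A \<noteq> {}" using exists_support[of s n A] s A0 by (metis empty_iff less_imp_le)
  then have "(SUP \<beta>\<in>alternative n s A. measure_pmf.prob (ergm n (1 / 2) \<beta>) {Y. total_degree_test n ?L Y = 0})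
      \<le> ratio_const * exp (1 / 2 - \<omega> ^ 5 + 81 * critical_const * \<omega> ^ 4)"
    unfolding 0 using alternative_prob_total_degree_le[OF n _ s(1) \<omega> A bd] by (rule cSUP_least)
  moreover have "?L / (n * sqrt n) = \<omega>" using n by simp
  ultimately show ?thesis
    unfolding risk_def 1 using prob_null_total_degree_gt[OF n, of ?L] by simp
qed

text \<open>This requires a member of the alternative: only then is the supremum of probabilities
  known to be nonnegative.\<close>

lemma risk_nonneg:
  assumes "s \<le> real n" "0 < s" "0 < A"
  shows "0 \<le> risk n \<theta> s A T"
proof -
  obtain S where alt: "vec n (\<lambda>i. if i \<in> S then A else 0) \<in> alternative n s A"
    using exists_support[of s n A] assms by (metis less_imp_le)
  have "0 \<le> measure_pmf.prob (ergm n \<theta> (vec n (\<lambda>i. if i \<in> S then A else 0))) {Y. T Y = 0}" by simp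
  also have "\<dots> \<le> (SUP \<beta>\<in>alternative n s A. measure_pmf.prob (ergm n \<theta> \<beta>) {Y. T Y = 0})"
    by (rule cSUP_upper[OF alt]) (auto intro: bdd_aboveI2[where M = 1])
  finally show ?thesis by (simp add: risk_def)
qed

theorem theorem1p8:
  fixes b t :: real
  assumes "0 < b" and "b < 1" and "t < 0"
  shows "(b + t + 1 / 2 < 0 \<longrightarrow>
           (\<forall>T. (\<forall>n. is_test n (T n)) \<longrightarrow>
              asymp_not_powerful (1 / 2) (\<lambda>n. real n powr b) (\<lambda>n. real n powr t) T)) \<and>
         (b + t + 1 / 2 > 0 \<longrightarrow>
           (\<exists>L. much_greater L (\<lambda>n. real n powr (3 / 2)) \<and>
              asymp_powerful (1 / 2) (\<lambda>n. real n powr b) (\<lambda>n. real n powr t)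
                (\<lambda>n. total_degree_test n (L n))))"
proof (intro conjI impI allI)
  fix T assume neg: "b + t + 1 / 2 < 0" and T: "\<forall>n. is_test n (T n)"
  define c where "c = 1 / (2 * (ratio_const * exp (1 / 4)))"
  have c: "0 < c" using ratio_const_ge_1 by (simp add: c_def)
  \<comment> \<open>The effective signal is n^(b + t + 1/2) and tends to 0.\<close>
  have "eventually (\<lambda>n. 2 * (real n powr t * real n powr b * sqrt n) \<le> 1) sequentially"
    using neg by real_asymp
  then have "eventually (\<lambda>n. ereal c \<le> ereal (risk n (1 / 2) (real n powr b) (real n powr t) (T n))) sequentially"
    using eventually_ge_at_top[of 64]
  proof eventually_elim
    case (elim n)
    have "real n powr b \<le> real n powr 1" using elim assms by (intro powr_mono) auto
    then have "c \<le> risk n (1 / 2) (real n powr b) (real n powr t) (T n)"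
      unfolding c_def using elim assms T by (intro risk_ge) (auto simp: ge_one_powr_ge_zero)
    then show ?case by simp
  qed
  then have "ereal c \<le> liminf (\<lambda>n. ereal (risk n (1 / 2) (real n powr b) (real n powr t) (T n)))"
    by (rule Liminf_bounded)
  then show "asymp_not_powerful (1 / 2) (\<lambda>n. real n powr b) (\<lambda>n. real n powr t) T"
    unfolding asymp_not_powerful_def using c by (metis ereal_less(2) less_le_trans)
next
  assume pos: "b + t + 1 / 2 > 0"
  \<comment> \<open>The first entry ensures that \<omega>^4 is at most the available signal A * s *
    sqrt n, the second that \<omega>^8 \<le> s.\<close>
  define e where "e = min ((b + t + 1 / 2) / 4) (b / 8)"
  have "e \<le> (b + t + 1 / 2) / 4" "e \<le> b / 8"
    unfolding e_def by (rule min.cobounded1, rule min.cobounded2)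
  then have e: "0 < e" "4 * e \<le> b + t + 1 / 2" "8 * e \<le> b"
    using pos assms by (auto simp: e_def)
  define \<omega> where "\<omega> n = real n powr e" for n :: nat
  define L where "L n = \<omega> n * (real n * sqrt n)" for n :: nat
  have \<omega>: "filterlim \<omega> at_top sequentially" unfolding \<omega>_def [abs_def] using e by real_asymp
  have "eventually (\<lambda>n. L n / real n powr (3 / 2) = \<omega> n) sequentially"
    using eventually_gt_at_top[of 0]
  proof eventually_elim
    case (elim n)
    have "real n powr (3 / 2) = real n powr (1 + 1 / 2)" by simp
    also have "\<dots> = real n * sqrt n" using elim by (simp only: powr_add powr_half_sqrt) simp
    finally show ?case using elim by (simp add: L_def)
  qed
  then have "much_greater L (\<lambda>n. real n powr (3 / 2))"
    unfolding much_greater_def using \<omega> by (simp add: filterlim_cong)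
  moreover have "asymp_powerful (1 / 2) (\<lambda>n. real n powr b) (\<lambda>n. real n powr t) (\<lambda>n. total_degree_test n (L n))"
    unfolding asymp_powerful_def
  proof -
    define U where "U x = ratio_const * exp (1 / 4) * exp (- x / 2)
      + ratio_const * exp (1 / 2 - x ^ 5 + 81 * critical_const * x ^ 4)" for x :: real
    \<comment> \<open>The fifth power beats the quartic cost, however large
      \<open>critical_const\<close> is.\<close>
    have "(U \<longlongrightarrow> 0) at_top" unfolding U_def [abs_def] by real_asymp
    then have U: "(\<lambda>n. U (\<omega> n)) \<longlonglongrightarrow> 0" using \<omega> by (rule filterlim_compose)
    have bounds: "0 < real n powr b" "real n powr b \<le> real n" "0 < real n powr t" if "64 \<le> n" for n :: nat
    proof -
      have "real n powr b \<le> real n powr 1" using that assms by (intro powr_mono) auto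
      then show "real n powr b \<le> real n" using that by simp
    qed (use that in auto)
    have upper: "eventually (\<lambda>n. risk n (1 / 2) (real n powr b) (real n powr t) (total_degree_test n (L n)) \<le> U (\<omega> n)) sequentially"
      using eventually_ge_at_top[of 64]
    proof eventually_elim
      case (elim n)
      have "\<omega> n ^ 4 = real n powr (4 * e)" "\<omega> n ^ 8 = real n powr (8 * e)"
        using elim by (simp_all add: \<omega>_def powr_power mult.commute)
      moreover have "real n powr (4 * e) \<le> real n powr (t + b + 1 / 2)" "real n powr (8 * e) \<le> real n powr b"
        using elim e by (auto intro!: powr_mono)
      moreover have "real n powr (t + b + 1 / 2) = real n powr t * real n powr b * sqrt n"
        by (simp only: powr_add powr_half_sqrt of_nat_0_le_iff)
      ultimately show ?case
        unfolding U_def L_def using elim bounds[OF elim]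
        by (intro risk_total_degree_test_le) (auto simp: \<omega>_def)
    qed
    have lower: "eventually (\<lambda>n. 0 \<le> risk n (1 / 2) (real n powr b) (real n powr t) (total_degree_test n (L n))) sequentially"
      using eventually_ge_at_top[of 64] by eventually_elim (rule risk_nonneg; simp add: bounds)
    show "(\<lambda>n. risk n (1 / 2) (real n powr b) (real n powr t) (total_degree_test n (L n))) \<longlonglongrightarrow> 0"
      by (rule tendsto_sandwich[OF lower upper tendsto_const U])
  qed
  ultimately show "\<exists>L. much_greater L (\<lambda>n. real n powr (3 / 2)) \<and>
      asymp_powerful (1 / 2) (\<lambda>n. real n powr b) (\<lambda>n. real n powr t) (\<lambda>n. total_degree_test n (L n))"
    by blast
qed

end
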